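(* Let $k$ be a field, $H$ a Hopf algebra over $k$, and $A$ a right $H$-comodule algebra over $k$ with structure map $\delta_A:A\to A\otimes H$ and subalgebra of coinvariants $B=A^{co\,H}$. Let $S\in\mathrm{Sub}_{Alg}(A/B)$. Then $$\psi(S)=H/K_S^+H,$$ where $K_S$ is the smallest element of $\mathrm{Sub}_{gen}(H)$ such that $\delta_A(S)\subseteq A\otimes K_S$, i.e. $$K_S=\bigcap\{K\in\mathrm{Sub}_{gen}(H):\delta_A(S)\subseteq A\otimes K\}.$$
   Context: A right $H$-comodule algebra is an algebra $A$ with a counital coassociative coaction $\delta_A:A\to A\otimes H$, $\delta_A(a)=a_{(0)}\otimes a_{(1)}$, that is an algebra homomorphism; $A^{co\,H}=\{a:\delta_A(a)=a\otimes 1_H\}$. $\mathrm{Sub}_{Alg}(A/B)$ is the poset (under inclusion) of subalgebras $S$ with $B\subseteq S\subseteq A$. $\mathrm{Sub}_{gen}(H)$ is the poset of left coideal subalgebras of $H$, i.e. unital subalgebras $K$ with $\Delta(K)\subseteq H\otimes K$. For such $K$, $K^+=K\cap\ker\epsilon$. $\mathrm{Quot}_{gen}(H)$ is the set of quotients $H/I$ by right ideal coideals $I$, ordered by $H/I\succcurlyeq H/J\Leftrightarrow I\subseteq J$; it is a complete lattice. For $Q\in\mathrm{Quot}_{gen}(H)$ with projection $\pi:H\to Q$, $A^{co\,Q}=\{a\in A:a_{(0)}\otimes\pi(a_{(1)})=a\otimes\pi(1_H)\}$. The map $\psi:\mathrm{Sub}_{Alg}(A/B)\to\mathrm{Quot}_{gen}(H)$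 is $\psi(S)=\bigvee\{Q\in\mathrm{Quot}_{gen}(H):S\subseteq A^{co\,Q}\}$; it is the unique map which forms a Galois connection with $\phi(Q)=A^{co\,Q}$. *)

theory Defs
  imports "HOL-Algebra.Subrings" "HOL-Algebra.Module"
begin

text \<open>
  Vector spaces over the ground field \<open>k\<close> are \<open>HOL-Algebra\<close> modules over \<open>k\<close>.  The record type
  \<^type>\<open>module\<close> extends \<^type>\<open>ring\<close>, so the same record also carries the multiplication and
  the unit of an algebra; for records that are used as bare modules these two fields are
  \<^const>\<open>undefined\<close>.
\<close>

section \<open>Linear algebra\<close>

definition linear_maps ::
    "('k, 'r) ring_scheme \<Rightarrow> ('k, 'a, 'm) module_scheme \<Rightarrow> ('k, 'b, 'n) module_scheme \<Rightarrow> ('a \<Rightarrow> 'b) set"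
  where "linear_maps k M N =
    {f \<in> carrier M \<rightarrow> carrier N.
       (\<forall>x\<in>carrier M. \<forall>y\<in>carrier M. f (x \<oplus>\<^bsub>M\<^esub> y) = f x \<oplus>\<^bsub>N\<^esub> f y) \<and>
       (\<forall>c\<in>carrier k. \<forall>x\<in>carrier M. f (c \<odot>\<^bsub>M\<^esub> x) = c \<odot>\<^bsub>N\<^esub> f x)}"

definition module_span ::
    "('k, 'r) ring_scheme \<Rightarrow> ('k, 'a, 'm) module_scheme \<Rightarrow> 'a set \<Rightarrow> 'a set"
  where "module_span k M Z = \<Inter>{N. submodule N k M \<and> Z \<subseteq> N}"

definition quotient_module :: "('k, 'a, 'm) module_scheme \<Rightarrow> 'a set \<Rightarrow> ('k, 'a set) module"
  where "quotient_module M N =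
    \<lparr>carrier = a_rcosets\<^bsub>M\<^esub> N, mult = undefined, one = undefined, zero = N, add = set_add M,
     smult = (\<lambda>c Z. \<Union>x\<in>Z. N +>\<^bsub>M\<^esub> (c \<odot>\<^bsub>M\<^esub> x))\<rparr>"

definition free_module :: "('k, 'r) ring_scheme \<Rightarrow> 'x set \<Rightarrow> ('k, 'x \<Rightarrow> 'k) module"
  where "free_module k Z =
    \<lparr>carrier = {f. (\<forall>x\<in>Z. f x \<in> carrier k) \<and> (\<forall>x. x \<notin> Z \<longrightarrow> f x = \<zero>\<^bsub>k\<^esub>) \<and> finite {x. f x \<noteq> \<zero>\<^bsub>k\<^esub>}},
     mult = undefined, one = undefined,
     zero = (\<lambda>x. \<zero>\<^bsub>k\<^esub>), add = (\<lambda>f g x. f x \<oplus>\<^bsub>k\<^esub> g x), smult = (\<lambda>c f x. c \<otimes>\<^bsub>k\<^esub> f x)\<rparr>"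

definition free_basis :: "('k, 'r) ring_scheme \<Rightarrow> 'x \<Rightarrow> 'x \<Rightarrow> 'k"
  where "free_basis k x = (\<lambda>y. if y = x then \<one>\<^bsub>k\<^esub> else \<zero>\<^bsub>k\<^esub>)"


section \<open>Tensor products\<close>

text \<open>
  \<open>M \<otimes> N\<close> is the free module on \<open>M \<times> N\<close> modulo the submodule generated by the bilinearity
  relations; its elements are cosets of finitely supported functions.
\<close>

definition tensor_relations ::
    "('k, 'r) ring_scheme \<Rightarrow> ('k, 'a, 'm) module_scheme \<Rightarrow> ('k, 'b, 'n) module_scheme
      \<Rightarrow> ('a \<times> 'b \<Rightarrow> 'k) set"
  where "tensor_relations k M N =
    (let F = free_module k (carrier M \<times> carrier N); e = (\<lambda>m n. free_basis k (m, n)) in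
     module_span k F
       ({e (m \<oplus>\<^bsub>M\<^esub> m') n \<ominus>\<^bsub>F\<^esub> (e m n \<oplus>\<^bsub>F\<^esub> e m' n) | m m' n.
           m \<in> carrier M \<and> m' \<in> carrier M \<and> n \<in> carrier N} \<union>
        {e m (n \<oplus>\<^bsub>N\<^esub> n') \<ominus>\<^bsub>F\<^esub> (e m n \<oplus>\<^bsub>F\<^esub> e m n') | m n n'.
           m \<in> carrier M \<and> n \<in> carrier N \<and> n' \<in> carrier N} \<union>
        {e (c \<odot>\<^bsub>M\<^esub> m) n \<ominus>\<^bsub>F\<^esub> c \<odot>\<^bsub>F\<^esub> e m n | c m n.
           c \<in> carrier k \<and> m \<in> carrier M \<and> n \<in> carrier N} \<union>
        {e m (c \<odot>\<^bsub>N\<^esub> n) \<ominus>\<^bsub>F\<^esub> c \<odot>\<^bsub>F\<^esub> e m n | c m n.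
           c \<in> carrier k \<and> m \<in> carrier M \<and> n \<in> carrier N}))"

definition tensor_module ::
    "('k, 'r) ring_scheme \<Rightarrow> ('k, 'a, 'm) module_scheme \<Rightarrow> ('k, 'b, 'n) module_scheme
      \<Rightarrow> ('k, ('a \<times> 'b \<Rightarrow> 'k) set) module"
  where "tensor_module k M N =
    quotient_module (free_module k (carrier M \<times> carrier N)) (tensor_relations k M N)"

definition pure_tensor ::
    "('k, 'r) ring_scheme \<Rightarrow> ('k, 'a, 'm) module_scheme \<Rightarrow> ('k, 'b, 'n) module_scheme
      \<Rightarrow> 'a \<Rightarrow> 'b \<Rightarrow> ('a \<times> 'b \<Rightarrow> 'k) set"
  where "pure_tensor k M N m n =
    tensor_relations k M N +>\<^bsub>free_module k (carrier M \<times> carrier N)\<^esub> free_basis k (m, n)"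

text \<open>
  The linear map \<open>M \<otimes> N \<rightarrow> P\<close> induced by a bilinear map \<open>f\<close>.  For bilinear \<open>f\<close> the linear
  extension of \<open>f\<close> to the free module is constant on each coset, so that the image of a coset
  is a singleton.
\<close>

definition tensor_lift ::
    "('k, 'r) ring_scheme \<Rightarrow> ('k, 'c, 'p) module_scheme \<Rightarrow> ('a \<Rightarrow> 'b \<Rightarrow> 'c)
      \<Rightarrow> ('a \<times> 'b \<Rightarrow> 'k) set \<Rightarrow> 'c"
  where "tensor_lift k P f Z =
    the_elem ((\<lambda>t. \<Oplus>\<^bsub>P\<^esub>p\<in>{p. t p \<noteq> \<zero>\<^bsub>k\<^esub>}. t p \<odot>\<^bsub>P\<^esub> f (fst p) (snd p)) ` Z)"

text \<open>The map \<open>f \<otimes> g\<close> into the tensor product of \<open>M'\<close> and \<open>N'\<close>.\<close>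

definition tensor_map ::
    "('k, 'r) ring_scheme \<Rightarrow> ('k, 'c, 'm) module_scheme \<Rightarrow> ('k, 'd, 'n) module_scheme
      \<Rightarrow> ('a \<Rightarrow> 'c) \<Rightarrow> ('b \<Rightarrow> 'd) \<Rightarrow> ('a \<times> 'b \<Rightarrow> 'k) set \<Rightarrow> ('c \<times> 'd \<Rightarrow> 'k) set"
  where "tensor_map k M' N' f g =
    tensor_lift k (tensor_module k M' N') (\<lambda>m n. pure_tensor k M' N' (f m) (g n))"

text \<open>The canonical isomorphism \<open>(M \<otimes> N) \<otimes> P \<rightarrow> M \<otimes> (N \<otimes> P)\<close>.\<close>

definition tensor_assoc ::
    "('k, 'r) ring_scheme \<Rightarrow> ('k, 'a, 'm) module_scheme \<Rightarrow> ('k, 'b, 'n) module_scheme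
      \<Rightarrow> ('k, 'c, 'p) module_scheme
      \<Rightarrow> (('a \<times> 'b \<Rightarrow> 'k) set \<times> 'c \<Rightarrow> 'k) set \<Rightarrow> ('a \<times> ('b \<times> 'c \<Rightarrow> 'k) set \<Rightarrow> 'k) set"
  where "tensor_assoc k M N P =
    (let NP = tensor_module k N P; T = tensor_module k M NP in
     tensor_lift k T (\<lambda>t p. tensor_lift k T (\<lambda>m n. pure_tensor k M NP m (pure_tensor k N P n p)) t))"

text \<open>The subspace \<open>U \<otimes> V\<close> of \<open>M \<otimes> N\<close>: the image of the map induced by the inclusions.\<close>

definition tensor_subspace ::
    "('k, 'r) ring_scheme \<Rightarrow> ('k, 'a, 'm) module_scheme \<Rightarrow> ('k, 'b, 'n) module_scheme
      \<Rightarrow> 'a set \<Rightarrow> 'b set \<Rightarrow> ('a \<times> 'b \<Rightarrow> 'k) set set"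
  where "tensor_subspace k M N U V =
    tensor_map k M N id id ` carrier (tensor_module k (M\<lparr>carrier := U\<rparr>) (N\<lparr>carrier := V\<rparr>))"

text \<open>The algebra structure on \<open>M \<otimes> N\<close>, with \<open>(m \<otimes> n) (m' \<otimes> n') = m m' \<otimes> n n'\<close>.\<close>

definition tensor_algebra ::
    "('k, 'r) ring_scheme \<Rightarrow> ('k, 'a, 'm) module_scheme \<Rightarrow> ('k, 'b, 'n) module_scheme
      \<Rightarrow> ('k, ('a \<times> 'b \<Rightarrow> 'k) set) module"
  where "tensor_algebra k M N =
    (let T = tensor_module k M N in
     T\<lparr>mult := (\<lambda>Z W. tensor_lift k T (\<lambda>m n. tensor_lift k T (\<lambda>m' n'.
                  pure_tensor k M N (m \<otimes>\<^bsub>M\<^esub> m') (n \<otimes>\<^bsub>N\<^esub> n')) W) Z),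
       one := pure_tensor k M N \<one>\<^bsub>M\<^esub> \<one>\<^bsub>N\<^esub>\<rparr>)"


section \<open>Hopf algebras and comodule algebras\<close>

text \<open>
  The locale \<^locale>\<open>algebra\<close> only covers commutative algebras.  As usual in \<open>HOL-Algebra\<close>,
  a ring is unital and may be zero.
\<close>

locale assoc_algebra = module k A + ring A for k (structure) and A (structure) +
  assumes smult_mult_left:
      "\<lbrakk>c \<in> carrier k; x \<in> carrier A; y \<in> carrier A\<rbrakk>
        \<Longrightarrow> (c \<odot>\<^bsub>A\<^esub> x) \<otimes>\<^bsub>A\<^esub> y = c \<odot>\<^bsub>A\<^esub> (x \<otimes>\<^bsub>A\<^esub> y)"
    and smult_mult_right:
      "\<lbrakk>c \<in> carrier k; x \<in> carrier A; y \<in> carrier A\<rbrakk>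
        \<Longrightarrow> x \<otimes>\<^bsub>A\<^esub> (c \<odot>\<^bsub>A\<^esub> y) = c \<odot>\<^bsub>A\<^esub> (x \<otimes>\<^bsub>A\<^esub> y)"

locale bialgebra = K: field k + H: assoc_algebra k H
  for k :: "('k, 'r) ring_scheme" (structure) and H :: "('k, 'h) module" (structure)
    and \<Delta> :: "'h \<Rightarrow> ('h \<times> 'h \<Rightarrow> 'k) set" and \<epsilon> :: "'h \<Rightarrow> 'k" +
  assumes comult_linear: "\<Delta> \<in> linear_maps k H (tensor_module k H H)"
    and comult_ring_hom: "\<Delta> \<in> ring_hom H (tensor_algebra k H H)"
    and counit_smult: "\<lbrakk>c \<in> carrier k; h \<in> carrier H\<rbrakk> \<Longrightarrow> \<epsilon> (c \<odot>\<^bsub>H\<^esub> h) = c \<otimes>\<^bsub>k\<^esub> \<epsilon> h"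
    and counit_ring_hom: "\<epsilon> \<in> ring_hom H k"
    and coassoc: "h \<in> carrier H \<Longrightarrow>
      tensor_assoc k H H H (tensor_map k (tensor_module k H H) H \<Delta> id (\<Delta> h)) =
      tensor_map k H (tensor_module k H H) id \<Delta> (\<Delta> h)"
    and counit_left: "h \<in> carrier H \<Longrightarrow> tensor_lift k H (\<lambda>x y. \<epsilon> x \<odot>\<^bsub>H\<^esub> y) (\<Delta> h) = h"
    and counit_right: "h \<in> carrier H \<Longrightarrow> tensor_lift k H (\<lambda>x y. \<epsilon> y \<odot>\<^bsub>H\<^esub> x) (\<Delta> h) = h"

locale hopf_algebra = bialgebra +
  assumes antipode_exists:
    "\<exists>\<sigma>\<in>linear_maps k H H. \<forall>h\<in>carrier H.
       tensor_lift k H (\<lambda>x y. \<sigma> x \<otimes>\<^bsub>H\<^esub> y) (\<Delta> h) = \<epsilon> h \<odot>\<^bsub>H\<^esub> \<one>\<^bsub>H\<^esub> \<and>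
       tensor_lift k H (\<lambda>x y. x \<otimes>\<^bsub>H\<^esub> \<sigma> y) (\<Delta> h) = \<epsilon> h \<odot>\<^bsub>H\<^esub> \<one>\<^bsub>H\<^esub>"

locale comodule_algebra = H: hopf_algebra k H \<Delta> \<epsilon> + A: assoc_algebra k A
  for k :: "('k, 'r) ring_scheme" (structure) and H :: "('k, 'h) module" (structure) and \<Delta> \<epsilon>
    and A :: "('k, 'a) module" (structure) and \<delta> :: "'a \<Rightarrow> ('a \<times> 'h \<Rightarrow> 'k) set" +
  assumes coact_linear: "\<delta> \<in> linear_maps k A (tensor_module k A H)"
    and coact_ring_hom: "\<delta> \<in> ring_hom A (tensor_algebra k A H)"
    and coact_coassoc: "a \<in> carrier A \<Longrightarrow>
      tensor_assoc k A H H (tensor_map k (tensor_module k A H) H \<delta> id (\<delta> a)) =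
      tensor_map k A (tensor_module k H H) id \<Delta> (\<delta> a)"
    and coact_counit: "a \<in> carrier A \<Longrightarrow> tensor_lift k A (\<lambda>x h. \<epsilon> h \<odot>\<^bsub>A\<^esub> x) (\<delta> a) = a"


section \<open>Subalgebras, quotients and coinvariants\<close>

definition is_subalgebra :: "('k, 'r) ring_scheme \<Rightarrow> ('k, 'a) module \<Rightarrow> 'a set \<Rightarrow> bool"
  where "is_subalgebra k A S \<longleftrightarrow> subring S A \<and> submodule S k A"

definition coinvariants ::
    "('k, 'r) ring_scheme \<Rightarrow> ('k, 'h) module \<Rightarrow> ('k, 'a) module
      \<Rightarrow> ('a \<Rightarrow> ('a \<times> 'h \<Rightarrow> 'k) set) \<Rightarrow> 'a set"
  where "coinvariants k H A \<delta> = {a \<in> carrier A. \<delta> a = pure_tensor k A H a \<one>\<^bsub>H\<^esub>}"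

definition Sub_Alg :: "('k, 'r) ring_scheme \<Rightarrow> ('k, 'a) module \<Rightarrow> 'a set \<Rightarrow> 'a set gorder"
  where "Sub_Alg k A B = \<lparr>carrier = {S. is_subalgebra k A S \<and> B \<subseteq> S}, eq = (=), le = (\<subseteq>)\<rparr>"

definition Sub_gen ::
    "('k, 'r) ring_scheme \<Rightarrow> ('k, 'h) module \<Rightarrow> ('h \<Rightarrow> ('h \<times> 'h \<Rightarrow> 'k) set) \<Rightarrow> 'h set gorder"
  where "Sub_gen k H \<Delta> =
    \<lparr>carrier = {K. is_subalgebra k H K \<and> \<Delta> ` K \<subseteq> tensor_subspace k H H (carrier H) K},
     eq = (=), le = (\<subseteq>)\<rparr>"

definition right_ideal :: "'a set \<Rightarrow> ('a, 'r) ring_scheme \<Rightarrow> bool"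
  where "right_ideal I R \<longleftrightarrow>
    additive_subgroup I R \<and> (\<forall>x\<in>I. \<forall>r\<in>carrier R. x \<otimes>\<^bsub>R\<^esub> r \<in> I)"

definition coideal ::
    "('k, 'r) ring_scheme \<Rightarrow> ('k, 'h) module \<Rightarrow> ('h \<Rightarrow> ('h \<times> 'h \<Rightarrow> 'k) set) \<Rightarrow> ('h \<Rightarrow> 'k)
      \<Rightarrow> 'h set \<Rightarrow> bool"
  where "coideal k H \<Delta> \<epsilon> I \<longleftrightarrow>
    submodule I k H \<and> (\<forall>x\<in>I. \<epsilon> x = \<zero>\<^bsub>k\<^esub>) \<and>
    \<Delta> ` I \<subseteq> tensor_subspace k H H I (carrier H)
              <+>\<^bsub>tensor_module k H H\<^esub> tensor_subspace k H H (carrier H) I"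

text \<open>
  The order is the one with \<open>H/J \<sqsubseteq> H/I\<close> iff \<open>I \<subseteq> J\<close>; the ideal \<open>I\<close> is recovered from the
  quotient \<open>H/I\<close> as its zero.
\<close>

definition Quot_gen ::
    "('k, 'r) ring_scheme \<Rightarrow> ('k, 'h) module \<Rightarrow> ('h \<Rightarrow> ('h \<times> 'h \<Rightarrow> 'k) set) \<Rightarrow> ('h \<Rightarrow> 'k)
      \<Rightarrow> ('k, 'h set) module gorder"
  where "Quot_gen k H \<Delta> \<epsilon> =
    \<lparr>carrier = {quotient_module H I | I. right_ideal I H \<and> coideal k H \<Delta> \<epsilon> I},
     eq = (=), le = (\<lambda>Q Q'. \<zero>\<^bsub>Q'\<^esub> \<subseteq> \<zero>\<^bsub>Q\<^esub>)\<rparr>"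

definition quotient_proj :: "('k, 'h) module \<Rightarrow> ('k, 'h set) module \<Rightarrow> 'h \<Rightarrow> 'h set"
  where "quotient_proj H Q h = \<zero>\<^bsub>Q\<^esub> +>\<^bsub>H\<^esub> h"

definition quotient_coinvariants ::
    "('k, 'r) ring_scheme \<Rightarrow> ('k, 'h) module \<Rightarrow> ('k, 'a) module
      \<Rightarrow> ('a \<Rightarrow> ('a \<times> 'h \<Rightarrow> 'k) set) \<Rightarrow> ('k, 'h set) module \<Rightarrow> 'a set"
  where "quotient_coinvariants k H A \<delta> Q =
    {a \<in> carrier A. tensor_map k A Q id (quotient_proj H Q) (\<delta> a) =
                    pure_tensor k A Q a (quotient_proj H Q \<one>\<^bsub>H\<^esub>)}"

definition galois_psi ::
    "('k, 'r) ring_scheme \<Rightarrow> ('k, 'h) module \<Rightarrow> ('h \<Rightarrow> ('h \<times> 'h \<Rightarrow> 'k) set) \<Rightarrow> ('h \<Rightarrow> 'k)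
      \<Rightarrow> ('k, 'a) module \<Rightarrow> ('a \<Rightarrow> ('a \<times> 'h \<Rightarrow> 'k) set) \<Rightarrow> 'a set \<Rightarrow> ('k, 'h set) module"
  where "galois_psi k H \<Delta> \<epsilon> A \<delta> S =
    \<Squnion>\<^bsub>Quot_gen k H \<Delta> \<epsilon>\<^esub>
      {Q \<in> carrier (Quot_gen k H \<Delta> \<epsilon>). S \<subseteq> quotient_coinvariants k H A \<delta> Q}"

definition augmentation_part :: "('k, 'r) ring_scheme \<Rightarrow> ('h \<Rightarrow> 'k) \<Rightarrow> 'h set \<Rightarrow> 'h set"
  where "augmentation_part k \<epsilon> K = {x \<in> K. \<epsilon> x = \<zero>\<^bsub>k\<^esub>}"

text \<open>\<open>U V\<close> for subspaces \<open>U\<close> and \<open>V\<close>: the span of all products.\<close>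

definition product_span ::
    "('k, 'r) ring_scheme \<Rightarrow> ('k, 'h) module \<Rightarrow> 'h set \<Rightarrow> 'h set \<Rightarrow> 'h set"
  where "product_span k H U V = module_span k H {u \<otimes>\<^bsub>H\<^esub> v | u v. u \<in> U \<and> v \<in> V}"

text \<open>The left coideal subalgebras \<open>K\<close> with \<open>\<delta>(S) \<subseteq> A \<otimes> K\<close>.\<close>

definition coaction_supports ::
    "('k, 'r) ring_scheme \<Rightarrow> ('k, 'h) module \<Rightarrow> ('h \<Rightarrow> ('h \<times> 'h \<Rightarrow> 'k) set)
      \<Rightarrow> ('k, 'a) module \<Rightarrow> ('a \<Rightarrow> ('a \<times> 'h \<Rightarrow> 'k) set) \<Rightarrow> 'a set \<Rightarrow> 'h set set"
  where "coaction_supports k H \<Delta> A \<delta> S =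
    {K \<in> carrier (Sub_gen k H \<Delta>). \<delta> ` S \<subseteq> tensor_subspace k A H (carrier A) K}"

end

theory Submission
  imports Defs
begin

text \<open>
  A functional \<open>f\<close> on \<open>A\<close> turns the coaction into a linear map \<open>\<delta>\<^sub>f : A \<rightarrow> H\<close> with
  \<open>\<delta>\<^sub>f a = f (a\<^sub>0) a\<^sub>1\<close>, the slice of \<open>\<delta> a\<close> along \<open>f\<close> (\<open>coeff f a\<close> below).  Over a field, slices
  see everything: two tensors are equal iff all their slices are, and a tensor lies in \<open>A \<otimes> V\<close>
  iff all its slices lie in \<open>V\<close> (\<open>mem_tensor_subspace_iff\<close>).  This rests on the existence of a
  functional that separates a vector from a subspace.  In terms of slices,

    \<^item> \<open>\<delta> s \<in> A \<otimes> K\<close> iff \<open>\<delta>\<^sub>f s \<in> K\<close> for all \<open>f\<close>;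
    \<^item> \<open>a\<close> is coinvariant for \<open>H/I\<close> iff \<open>\<delta>\<^sub>f a - f(a) 1 \<in> I\<close> for all \<open>f\<close>;
    \<^item> the counit law says \<open>\<epsilon> (\<delta>\<^sub>f a) = f a\<close>, and coassociativity says
      \<open>\<Delta>\<^sub>g (\<delta>\<^sub>f a) = \<delta>\<^sub>h a\<close> where \<open>h = g \<circ> \<delta>\<^sub>f\<close> is again a functional on \<open>A\<close>.

  The first line shows that the left coideal subalgebras \<open>K\<close> with \<open>\<delta>(S) \<subseteq> A \<otimes> K\<close> are closed under
  intersections, so that \<open>K\<^sub>S\<close> is the smallest of them.  Let \<open>J = K\<^sub>S\<^sup>+ H\<close>.  The supremum defining
  \<open>\<psi>(S)\<close> is in fact a maximum, attained at \<open>H/J\<close>, for three reasons.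

    \<^item> \<open>J\<close> is a right ideal coideal (\<open>augmentation_ideal_coideal\<close>).
    \<^item> \<open>S\<close> is coinvariant for \<open>H/J\<close>: since \<open>\<delta>\<^sub>f s \<in> K\<^sub>S\<close>, the element
      \<open>\<delta>\<^sub>f s - f(s) 1 = \<delta>\<^sub>f s - \<epsilon> (\<delta>\<^sub>f s) 1\<close> lies in \<open>K\<^sub>S\<^sup>+\<close>.
    \<^item> If \<open>S\<close> is coinvariant for \<open>H/I\<close>, let \<open>C\<close> be the space of \<open>H/I\<close>-coinvariants of \<open>H\<close> itself.
      It is a left coideal subalgebra, and the coassociativity law above gives \<open>\<delta>(S) \<subseteq> A \<otimes> C\<close>; hence
      \<open>K\<^sub>S \<subseteq> C\<close>.  An \<open>h \<in> C\<close> with \<open>\<epsilon> h = 0\<close> lies in \<open>I\<close>, because \<open>\<Delta>\<^sub>\<epsilon> h = h\<close>.  So \<open>J \<subseteq> I\<close>.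

  That \<open>C\<close> is a left coideal is the inclusion \<open>\<delta>(S) \<subseteq> A \<otimes> C\<close> for the regular comodule algebra
  \<open>A = H\<close> and \<open>S = C\<close>.
\<close>

section \<open>Linear maps and quotient modules\<close>

lemma linear_mapsI:
  assumes "\<And>x. x \<in> carrier M \<Longrightarrow> f x \<in> carrier N"
    and "\<And>x y. \<lbrakk>x \<in> carrier M; y \<in> carrier M\<rbrakk> \<Longrightarrow> f (x \<oplus>\<^bsub>M\<^esub> y) = f x \<oplus>\<^bsub>N\<^esub> f y"
    and "\<And>c x. \<lbrakk>c \<in> carrier k; x \<in> carrier M\<rbrakk> \<Longrightarrow> f (c \<odot>\<^bsub>M\<^esub> x) = c \<odot>\<^bsub>N\<^esub> f x"
  shows "f \<in> linear_maps k M N"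
  using assms unfolding linear_maps_def by auto

lemma linear_maps_closed: "\<lbrakk>f \<in> linear_maps k M N; x \<in> carrier M\<rbrakk> \<Longrightarrow> f x \<in> carrier N"
  unfolding linear_maps_def by auto

lemma linear_maps_add:
  "\<lbrakk>f \<in> linear_maps k M N; x \<in> carrier M; y \<in> carrier M\<rbrakk> \<Longrightarrow> f (x \<oplus>\<^bsub>M\<^esub> y) = f x \<oplus>\<^bsub>N\<^esub> f y"
  unfolding linear_maps_def by auto

lemma linear_maps_smult:
  "\<lbrakk>f \<in> linear_maps k M N; c \<in> carrier k; x \<in> carrier M\<rbrakk> \<Longrightarrow> f (c \<odot>\<^bsub>M\<^esub> x) = c \<odot>\<^bsub>N\<^esub> f x"
  unfolding linear_maps_def by auto

lemma linear_maps_zero: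
  assumes "module k M" "module k N" "f \<in> linear_maps k M N"
  shows "f \<zero>\<^bsub>M\<^esub> = \<zero>\<^bsub>N\<^esub>"
proof -
  interpret M: module k M by fact
  interpret N: module k N by fact
  have "f (\<zero>\<^bsub>k\<^esub> \<odot>\<^bsub>M\<^esub> \<zero>\<^bsub>M\<^esub>) = \<zero>\<^bsub>k\<^esub> \<odot>\<^bsub>N\<^esub> f \<zero>\<^bsub>M\<^esub>"
    using assms(3) by (intro linear_maps_smult) auto
  then show ?thesis
    using linear_maps_closed[OF assms(3), of "\<zero>\<^bsub>M\<^esub>"] by simp
qed

lemma linear_maps_uminus:
  assumes "module k M" "module k N" "f \<in> linear_maps k M N" "x \<in> carrier M"
  shows "f (\<ominus>\<^bsub>M\<^esub> x) = \<ominus>\<^bsub>N\<^esub> f x"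
proof -
  interpret M: module k M by fact
  interpret N: module k N by fact
  have "f (\<ominus>\<^bsub>M\<^esub> x) = f ((\<ominus>\<^bsub>k\<^esub> \<one>\<^bsub>k\<^esub>) \<odot>\<^bsub>M\<^esub> x)"
    using assms(4) by (simp add: M.smult_l_minus)
  also have "\<dots> = (\<ominus>\<^bsub>k\<^esub> \<one>\<^bsub>k\<^esub>) \<odot>\<^bsub>N\<^esub> f x"
    using assms(3,4) by (intro linear_maps_smult) auto
  also have "\<dots> = \<ominus>\<^bsub>N\<^esub> f x"
    using linear_maps_closed[OF assms(3,4)] by (simp add: N.smult_l_minus)
  finally show ?thesis .
qed

lemma linear_maps_minus:
  assumes "module k M" "module k N" "f \<in> linear_maps k M N" "x \<in> carrier M" "y \<in> carrier M"
  shows "f (x \<ominus>\<^bsub>M\<^esub> y) = f x \<ominus>\<^bsub>N\<^esub> f y"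
proof -
  interpret M: module k M by fact
  show ?thesis
    unfolding a_minus_def
    using assms(4,5) by (simp add: linear_maps_add[OF assms(3)] linear_maps_uminus[OF assms(1-3)])
qed

lemma linear_maps_compose:
  "\<lbrakk>f \<in> linear_maps k M N; g \<in> linear_maps k N P\<rbrakk> \<Longrightarrow> (\<lambda>x. g (f x)) \<in> linear_maps k M P"
  unfolding linear_maps_def by (auto simp: Pi_iff)

lemma linear_maps_sum:
  assumes "module k P" "f \<in> linear_maps k M P" "g \<in> linear_maps k M P"
  shows "(\<lambda>x. f x \<oplus>\<^bsub>P\<^esub> g x) \<in> linear_maps k M P"
proof -
  interpret P: module k P by fact
  note f = linear_maps_closed[OF assms(2)] and g = linear_maps_closed[OF assms(3)]
  show ?thesis
  proof (rule linear_mapsI)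
    fix x y assume xy: "x \<in> carrier M" "y \<in> carrier M"
    show "f (x \<oplus>\<^bsub>M\<^esub> y) \<oplus>\<^bsub>P\<^esub> g (x \<oplus>\<^bsub>M\<^esub> y) = (f x \<oplus>\<^bsub>P\<^esub> g x) \<oplus>\<^bsub>P\<^esub> (f y \<oplus>\<^bsub>P\<^esub> g y)"
      using f[OF xy(1)] f[OF xy(2)] g[OF xy(1)] g[OF xy(2)]
      by (simp add: linear_maps_add[OF assms(2) xy] linear_maps_add[OF assms(3) xy] P.M.a_ac)
  qed (simp_all add: f g linear_maps_smult[OF assms(2)] linear_maps_smult[OF assms(3)]
      P.smult_r_distr)
qed

lemma linear_maps_scaled:
  assumes "module k P" "c \<in> carrier k" "f \<in> linear_maps k M P"
  shows "(\<lambda>x. c \<odot>\<^bsub>P\<^esub> f x) \<in> linear_maps k M P"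
proof -
  interpret P: module k P by fact
  note f = linear_maps_closed[OF assms(3)]
  show ?thesis
  proof (rule linear_mapsI)
    fix d x assume dx: "d \<in> carrier k" "x \<in> carrier M"
    have "c \<odot>\<^bsub>P\<^esub> (d \<odot>\<^bsub>P\<^esub> f x) = (d \<otimes>\<^bsub>k\<^esub> c) \<odot>\<^bsub>P\<^esub> f x"
      using dx f[OF dx(2)] assms(2) by (simp add: P.smult_assoc1[symmetric] P.R.m_comm)
    then show "c \<odot>\<^bsub>P\<^esub> f (d \<odot>\<^bsub>M\<^esub> x) = d \<odot>\<^bsub>P\<^esub> (c \<odot>\<^bsub>P\<^esub> f x)"
      using dx f[OF dx(2)] assms(2) by (simp add: linear_maps_smult[OF assms(3)] P.smult_assoc1)
  qed (simp_all add: f assms(2) linear_maps_add[OF assms(3)] P.smult_r_distr)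
qed

lemma linear_maps_difference:
  assumes "module k P" "f \<in> linear_maps k M P" "g \<in> linear_maps k M P"
  shows "(\<lambda>x. f x \<ominus>\<^bsub>P\<^esub> g x) \<in> linear_maps k M P"
proof -
  interpret P: module k P by fact
  note f = linear_maps_closed[OF assms(2)] and g = linear_maps_closed[OF assms(3)]
  show ?thesis
  proof (rule linear_mapsI)
    fix x y assume xy: "x \<in> carrier M" "y \<in> carrier M"
    show "f (x \<oplus>\<^bsub>M\<^esub> y) \<ominus>\<^bsub>P\<^esub> g (x \<oplus>\<^bsub>M\<^esub> y) = (f x \<ominus>\<^bsub>P\<^esub> g x) \<oplus>\<^bsub>P\<^esub> (f y \<ominus>\<^bsub>P\<^esub> g y)"
      using f[OF xy(1)] f[OF xy(2)] g[OF xy(1)] g[OF xy(2)]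
      by (simp add: linear_maps_add[OF assms(2) xy] linear_maps_add[OF assms(3) xy] a_minus_def
          P.M.minus_add P.M.a_ac)
  qed (simp_all add: f g linear_maps_smult[OF assms(2)] linear_maps_smult[OF assms(3)] a_minus_def
      P.smult_r_distr P.smult_r_minus)
qed

lemma linear_maps_preimage:
  assumes "module k M" "module k P" "f \<in> linear_maps k M P" "submodule N k P"
  shows "submodule {x \<in> carrier M. f x \<in> N} k M"
proof -
  interpret M: module k M by fact
  interpret P: module k P by fact
  note N = P.submoduleE[OF assms(4)] subgroup.one_closed[OF submodule.axioms(1)[OF assms(4)]]
  show ?thesis
    by (rule M.submoduleI)
      (use N in \<open>auto simp: linear_maps_zero[OF assms(1-3)] linear_maps_uminus[OF assms(1-3)]
        linear_maps_add[OF assms(3)] linear_maps_smult[OF assms(3)]\<close>)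
qed

lemma linear_maps_image:
  assumes "module k M" "module k P" "f \<in> linear_maps k M P"
  shows "submodule (f ` carrier M) k P"
proof -
  interpret M: module k M by fact
  interpret P: module k P by fact
  show ?thesis
  proof (rule P.submoduleI)
    show "f ` carrier M \<subseteq> carrier P"
      using linear_maps_closed[OF assms(3)] by blast
    show "\<zero>\<^bsub>P\<^esub> \<in> f ` carrier M"
      using linear_maps_zero[OF assms] M.M.zero_closed by (metis image_eqI)
  qed (auto simp: linear_maps_uminus[OF assms, symmetric] linear_maps_add[OF assms(3), symmetric]
      linear_maps_smult[OF assms(3), symmetric])
qed

context module begin

lemma zero_submodule: "submodule {\<zero>\<^bsub>M\<^esub>} R M"
  by (rule submoduleI) auto

lemma submodule_zero: "submodule N R M \<Longrightarrow> \<zero>\<^bsub>M\<^esub> \<in> N"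
  using subgroup.one_closed[OF submodule.axioms(1)] by fastforce

lemma submodule_minus: "\<lbrakk>submodule N R M; x \<in> N; y \<in> N\<rbrakk> \<Longrightarrow> x \<ominus>\<^bsub>M\<^esub> y \<in> N"
  unfolding a_minus_def by (simp add: submoduleE)

lemma submodule_Inter:
  assumes "\<And>N. N \<in> \<N> \<Longrightarrow> submodule N R M" "\<N> \<noteq> {}"
  shows "submodule (\<Inter>\<N>) R M"
proof (rule submoduleI)
  show "\<Inter>\<N> \<subseteq> carrier M"
    using assms submoduleE(1) by blast
qed (use assms in \<open>auto simp: submodule_zero dest: submoduleE\<close>)

lemma submodule_module_span: "Z \<subseteq> carrier M \<Longrightarrow> submodule (module_span R M Z) R M"
  unfolding module_span_def by (rule submodule_Inter) (use carrier_is_submodule in auto)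

lemma module_span_superset: "Z \<subseteq> module_span R M Z"
  unfolding module_span_def by blast

lemma module_span_least: "\<lbrakk>submodule N R M; Z \<subseteq> N\<rbrakk> \<Longrightarrow> module_span R M Z \<subseteq> N"
  unfolding module_span_def by blast

lemma minus_eq_zero_iff: "\<lbrakk>x \<in> carrier M; y \<in> carrier M\<rbrakk> \<Longrightarrow> x \<ominus>\<^bsub>M\<^esub> y = \<zero>\<^bsub>M\<^esub> \<longleftrightarrow> x = y"
  by (metis M.r_neg M.minus_equality M.minus_minus M.a_inv_closed a_minus_def M.a_comm)

end

lemma (in module) submodule_set_add:
  assumes U: "submodule U R M" and V: "submodule V R M"
  shows "submodule (U <+>\<^bsub>M\<^esub> V) R M"
proof (rule submoduleI)
  note UM = subsetD[OF submoduleE(1)[OF U]] and VM = subsetD[OF submoduleE(1)[OF V]]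
  have mem: "x \<in> U <+>\<^bsub>M\<^esub> V \<longleftrightarrow> (\<exists>u\<in>U. \<exists>v\<in>V. x = u \<oplus>\<^bsub>M\<^esub> v)" for x
    by (auto simp: set_add_def')
  show "U <+>\<^bsub>M\<^esub> V \<subseteq> carrier M"
    using UM VM by (auto simp: mem)
  show "\<zero>\<^bsub>M\<^esub> \<in> U <+>\<^bsub>M\<^esub> V"
    using submodule_zero[OF U] submodule_zero[OF V] M.l_zero[OF M.zero_closed] unfolding mem by metis
  fix x assume "x \<in> U <+>\<^bsub>M\<^esub> V"
  then obtain u v where x: "u \<in> U" "v \<in> V" "x = u \<oplus>\<^bsub>M\<^esub> v" unfolding mem by blast
  have "\<ominus>\<^bsub>M\<^esub> x = \<ominus>\<^bsub>M\<^esub> u \<oplus>\<^bsub>M\<^esub> \<ominus>\<^bsub>M\<^esub> v"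
    using x UM VM by (simp add: M.minus_add)
  then show "\<ominus>\<^bsub>M\<^esub> x \<in> U <+>\<^bsub>M\<^esub> V"
    using x submoduleE(3)[OF U] submoduleE(3)[OF V] unfolding mem by blast
  show "c \<odot>\<^bsub>M\<^esub> x \<in> U <+>\<^bsub>M\<^esub> V" if c: "c \<in> carrier R" for c
  proof -
    have "c \<odot>\<^bsub>M\<^esub> x = c \<odot>\<^bsub>M\<^esub> u \<oplus>\<^bsub>M\<^esub> c \<odot>\<^bsub>M\<^esub> v"
      using x UM VM c by (simp add: smult_r_distr)
    then show ?thesis
      using x c submoduleE(4)[OF U] submoduleE(4)[OF V] unfolding mem by blast
  qed
  fix y assume "y \<in> U <+>\<^bsub>M\<^esub> V"
  then obtain u' v' where y: "u' \<in> U" "v' \<in> V" "y = u' \<oplus>\<^bsub>M\<^esub> v'" unfolding mem by blast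
  have "x \<oplus>\<^bsub>M\<^esub> y = (u \<oplus>\<^bsub>M\<^esub> u') \<oplus>\<^bsub>M\<^esub> (v \<oplus>\<^bsub>M\<^esub> v')"
    using x y UM VM by (simp add: M.a_ac)
  then show "x \<oplus>\<^bsub>M\<^esub> y \<in> U <+>\<^bsub>M\<^esub> V"
    using x y submoduleE(5)[OF U] submoduleE(5)[OF V] unfolding mem by blast
qed

lemma zero_quotient_module [simp]: "\<zero>\<^bsub>quotient_module M N\<^esub> = N"
  and carrier_quotient_module: "carrier (quotient_module M N) = a_rcosets\<^bsub>M\<^esub> N"
  and add_quotient_module [simp]: "add (quotient_module M N) = set_add M"
  by (simp_all add: quotient_module_def)

locale quotient_by = M: module k M for k :: "('k, 'r) ring_scheme" and M :: "('k, 'a, 'm) module_scheme" +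
  fixes N :: "'a set"
  assumes sub: "submodule N k M"
begin

sublocale abelian_subgroup N M
  using submodule.axioms(1)[OF sub] M.M.abelian_group_axioms
  by (intro abelian_subgroupI3) (auto simp: additive_subgroup_def)

abbreviation coset :: "'a \<Rightarrow> 'a set" where "coset x \<equiv> N +>\<^bsub>M\<^esub> x"

lemma coset_closed [simp, intro]: "x \<in> carrier M \<Longrightarrow> coset x \<in> carrier (quotient_module M N)"
  unfolding carrier_quotient_module by (rule M.M.a_rcosetsI) (rule a_subset)

lemma coset_exhaust:
  assumes "Z \<in> carrier (quotient_module M N)"
  obtains x where "x \<in> carrier M" "Z = coset x"
  using assms unfolding carrier_quotient_module A_RCOSETS_def' by blast

lemma coset_eq_iff:
  assumes "x \<in> carrier M" "y \<in> carrier M"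
  shows "coset x = coset y \<longleftrightarrow> x \<ominus>\<^bsub>M\<^esub> y \<in> N"
proof
  assume "coset x = coset y"
  then have "x \<in> coset y" using a_rcos_self[OF assms(1)] by simp
  then show "x \<ominus>\<^bsub>M\<^esub> y \<in> N"
    using a_rcos_module_minus[of y x] assms M.M.abelian_group_axioms
    by (metis (no_types, lifting) a_rcos_module a_minus_def)
next
  assume "x \<ominus>\<^bsub>M\<^esub> y \<in> N"
  then have "x \<in> coset y"
    using a_rcos_module assms by (simp add: a_minus_def)
  then show "coset x = coset y"
    using a_repr_independence' assms by metis
qed

lemma coset_add: "\<lbrakk>x \<in> carrier M; y \<in> carrier M\<rbrakk> \<Longrightarrow>
    coset x \<oplus>\<^bsub>quotient_module M N\<^esub> coset y = coset (x \<oplus>\<^bsub>M\<^esub> y)"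
  using a_rcos_sum by simp

lemma coset_smult:
  assumes "c \<in> carrier k" "x \<in> carrier M"
  shows "c \<odot>\<^bsub>quotient_module M N\<^esub> coset x = coset (c \<odot>\<^bsub>M\<^esub> x)"
proof -
  have "coset (c \<odot>\<^bsub>M\<^esub> y) = coset (c \<odot>\<^bsub>M\<^esub> x)" if y: "y \<in> coset x" for y
  proof -
    have yM: "y \<in> carrier M"
      using y assms a_elemrcos_carrier by blast
    have yx: "y \<ominus>\<^bsub>M\<^esub> x \<in> N" 
      using a_rcos_module[of x y] assms y yM by (simp add: a_minus_def)
    have "c \<odot>\<^bsub>M\<^esub> y \<ominus>\<^bsub>M\<^esub> c \<odot>\<^bsub>M\<^esub> x = c \<odot>\<^bsub>M\<^esub> (y \<ominus>\<^bsub>M\<^esub> x)"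
      using assms yM by (simp add: a_minus_def M.smult_r_distr M.smult_r_minus)
    then have "c \<odot>\<^bsub>M\<^esub> y \<ominus>\<^bsub>M\<^esub> c \<odot>\<^bsub>M\<^esub> x \<in> N"
      using yx assms M.submoduleE(4)[OF sub] by simp
    then show ?thesis
      using coset_eq_iff assms yM by simp
  qed
  moreover have "x \<in> coset x"
    using assms a_rcos_self by simp
  ultimately have "(\<Union>y\<in>coset x. coset (c \<odot>\<^bsub>M\<^esub> y)) = coset (c \<odot>\<^bsub>M\<^esub> x)"
    by blast
  then show ?thesis
    by (simp add: quotient_module_def)
qed

lemma coset_zero: "coset \<zero>\<^bsub>M\<^esub> = N"
  using M.M.a_coset_add_zero a_subset by simp

lemma zero_coset: "\<zero>\<^bsub>quotient_module M N\<^esub> = coset \<zero>\<^bsub>M\<^esub>"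
  by (simp add: coset_zero)

lemma quotient_module: "module k (quotient_module M N)"
proof (rule moduleI)
  show "cring k" by (rule M.R.cring_axioms)
  show "abelian_group (quotient_module M N)"
  proof (rule abelian_groupI)
    show "\<zero>\<^bsub>quotient_module M N\<^esub> \<in> carrier (quotient_module M N)"
      using coset_closed[of "\<zero>\<^bsub>M\<^esub>"] coset_zero by simp
    show "\<exists>y\<in>carrier (quotient_module M N). y \<oplus>\<^bsub>quotient_module M N\<^esub> Z = \<zero>\<^bsub>quotient_module M N\<^esub>"
      if Z: "Z \<in> carrier (quotient_module M N)" for Z
    proof -
      obtain x where x: "x \<in> carrier M" "Z = coset x"
        using coset_exhaust[OF Z] by blast
      have "coset (\<ominus>\<^bsub>M\<^esub> x) \<oplus>\<^bsub>quotient_module M N\<^esub> Z = N"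
        using x coset_add[of "\<ominus>\<^bsub>M\<^esub> x" x] by (simp add: M.M.l_neg coset_zero del: add_quotient_module)
      then show ?thesis
        using x by (auto intro!: bexI[of _ "coset (\<ominus>\<^bsub>M\<^esub> x)"] simp del: add_quotient_module)
    qed
  qed (auto elim!: coset_exhaust simp: coset_add M.M.a_ac zero_coset
      simp del: add_quotient_module zero_quotient_module)
qed (auto elim!: coset_exhaust simp: coset_add coset_smult M.smult_l_distr M.smult_r_distr
    M.smult_assoc1 simp del: add_quotient_module)

lemma coset_linear: "coset \<in> linear_maps k M (quotient_module M N)"
  by (rule linear_mapsI) (simp_all add: coset_add coset_smult del: add_quotient_module)

end

section \<open>Free modules\<close>

text \<open>
  The linear extension to the free module of a map on its basis; \<^const>\<open>tensor_lift\<close> evaluates it on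
  the representatives of a coset.
\<close>

definition free_extension ::
    "('k, 'r) ring_scheme \<Rightarrow> ('k, 'c, 'p) module_scheme \<Rightarrow> ('x \<Rightarrow> 'c) \<Rightarrow> ('x \<Rightarrow> 'k) \<Rightarrow> 'c"
  where "free_extension k P f t = (\<Oplus>\<^bsub>P\<^esub>x\<in>{x. t x \<noteq> \<zero>\<^bsub>k\<^esub>}. t x \<odot>\<^bsub>P\<^esub> f x)"

lemma free_module_simps [simp]:
  "\<zero>\<^bsub>free_module k Z\<^esub> = (\<lambda>x. \<zero>\<^bsub>k\<^esub>)"
  "f \<oplus>\<^bsub>free_module k Z\<^esub> g = (\<lambda>x. f x \<oplus>\<^bsub>k\<^esub> g x)"
  "c \<odot>\<^bsub>free_module k Z\<^esub> f = (\<lambda>x. c \<otimes>\<^bsub>k\<^esub> f x)"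
  by (simp_all add: free_module_def)

context cring begin

lemma mem_free_module:
  "f \<in> carrier (free_module R Z) \<longleftrightarrow>
    (\<forall>x. f x \<in> carrier R) \<and> {x. f x \<noteq> \<zero>} \<subseteq> Z \<and> finite {x. f x \<noteq> \<zero>}"
  by (auto simp: free_module_def)

lemma free_module: "module R (free_module R Z)"
proof (rule moduleI)
  show "abelian_group (free_module R Z)"
  proof (rule abelian_groupI)
    fix f g assume f: "f \<in> carrier (free_module R Z)" and g: "g \<in> carrier (free_module R Z)"
    have "{x. f x \<oplus> g x \<noteq> \<zero>} \<subseteq> {x. f x \<noteq> \<zero>} \<union> {x. g x \<noteq> \<zero>}"
      by auto
    then show "f \<oplus>\<^bsub>free_module R Z\<^esub> g \<in> carrier (free_module R Z)"
      using f g unfolding mem_free_module free_module_simps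
      by (auto dest: finite_subset)
  next
    fix f assume f: "f \<in> carrier (free_module R Z)"
    then have "{x. \<ominus> f x \<noteq> \<zero>} = {x. f x \<noteq> \<zero>}"
      by (auto simp: mem_free_module)
    then show "\<exists>g\<in>carrier (free_module R Z). g \<oplus>\<^bsub>free_module R Z\<^esub> f = \<zero>\<^bsub>free_module R Z\<^esub>"
      using f by (intro bexI[of _ "\<lambda>x. \<ominus> f x"]) (auto simp: mem_free_module l_neg)
  qed (auto simp: mem_free_module a_ac fun_eq_iff)
  show "cring R" by (rule cring_axioms)
  fix c f assume c: "c \<in> carrier R" and f: "f \<in> carrier (free_module R Z)"
  have "{x. c \<otimes> f x \<noteq> \<zero>} \<subseteq> {x. f x \<noteq> \<zero>}"
    using c by auto
  then show "c \<odot>\<^bsub>free_module R Z\<^esub> f \<in> carrier (free_module R Z)"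
    using c f unfolding mem_free_module free_module_simps
    by (auto dest: finite_subset)
qed (auto simp: mem_free_module fun_eq_iff l_distr r_distr m_assoc)

lemma free_basis_closed: "x \<in> Z \<Longrightarrow> free_basis R x \<in> carrier (free_module R Z)"
  by (auto simp: mem_free_module free_basis_def)

text \<open>
  A finitely supported function is built up from zero one basis vector at a time; this is how
  statements about all tensors are reduced to pure tensors.
\<close>

lemma free_module_induct [consumes 1, case_names zero add]:
  assumes t: "t \<in> carrier (free_module R Z)"
    and zero: "P \<zero>\<^bsub>free_module R Z\<^esub>"
    and add: "\<And>c x t. \<lbrakk>c \<in> carrier R; x \<in> Z; t \<in> carrier (free_module R Z); P t\<rbrakk> \<Longrightarrow>
      P (c \<odot>\<^bsub>free_module R Z\<^esub> free_basis R x \<oplus>\<^bsub>free_module R Z\<^esub> t)"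
  shows "P t"
proof -
  have "finite {x. t x \<noteq> \<zero>}"
    using t by (simp add: mem_free_module)
  then show ?thesis
    using t
  proof (induction "{x. t x \<noteq> \<zero>}" arbitrary: t rule: finite_induct)
    case empty
    then have "t = \<zero>\<^bsub>free_module R Z\<^esub>" by auto
    then show ?case using zero by simp
  next
    case (insert x S)
    let ?t = "t(x := \<zero>)"
    have S: "S = {y. ?t y \<noteq> \<zero>}"
      using insert.hyps by auto
    have x: "x \<in> Z" and tx: "t x \<in> carrier R"
      using insert.hyps insert.prems by (auto simp: mem_free_module)
    have t': "?t \<in> carrier (free_module R Z)"
      using insert.prems insert.hyps(1) S by (auto simp: mem_free_module)
    have "t = t x \<odot>\<^bsub>free_module R Z\<^esub> free_basis R x \<oplus>\<^bsub>free_module R Z\<^esub> ?t"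
      using insert.prems by (auto simp: mem_free_module free_basis_def fun_eq_iff)
    then show ?case
      using add[OF tx x t' insert.hyps(3)[OF S t']] by simp
  qed
qed

end

context module begin

lemma free_extension_superset:
  assumes "t \<in> carrier (free_module R Z)" "f \<in> Z \<rightarrow> carrier M" "finite C" "{x. t x \<noteq> \<zero>} \<subseteq> C" "C \<subseteq> Z"
  shows "free_extension R M f t = (\<Oplus>\<^bsub>M\<^esub>x\<in>C. t x \<odot>\<^bsub>M\<^esub> f x)"
  unfolding free_extension_def
  by (rule M.add.finprod_mono_neutral_cong_left)
    (use assms in \<open>auto simp: R.mem_free_module Pi_iff\<close>)

lemma free_extension_linear:
  assumes f: "f \<in> Z \<rightarrow> carrier M"
  shows "free_extension R M f \<in> linear_maps R (free_module R Z) M"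
proof (rule linear_mapsI)
  fix t assume t: "t \<in> carrier (free_module R Z)"
  then show "free_extension R M f t \<in> carrier M"
    unfolding free_extension_def using f
    by (intro M.finsum_closed) (auto simp: R.mem_free_module Pi_iff)
  fix c assume c: "c \<in> carrier R"
  let ?S = "{x. t x \<noteq> \<zero>}"
  have S: "finite ?S" "?S \<subseteq> Z" and tc: "t x \<in> carrier R" for x
    using t by (auto simp: R.mem_free_module)
  have "free_extension R M f (c \<odot>\<^bsub>free_module R Z\<^esub> t) =
      (\<Oplus>\<^bsub>M\<^esub>x\<in>?S. (c \<odot>\<^bsub>free_module R Z\<^esub> t) x \<odot>\<^bsub>M\<^esub> f x)"
    using c module.smult_closed[OF R.free_module c t] f S
    by (intro free_extension_superset[of _ Z]) auto
  also have "\<dots> = (\<Oplus>\<^bsub>M\<^esub>x\<in>?S. c \<odot>\<^bsub>M\<^esub> (t x \<odot>\<^bsub>M\<^esub> f x))"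
    using c tc f S by (intro M.finsum_cong') (auto simp: smult_assoc1 Pi_iff subset_iff)
  also have "\<dots> = c \<odot>\<^bsub>M\<^esub> free_extension R M f t"
    unfolding free_extension_def
    using c tc f S by (subst finsum_smult_ldistr) (auto simp: Pi_iff subset_iff)
  finally show "free_extension R M f (c \<odot>\<^bsub>free_module R Z\<^esub> t) = c \<odot>\<^bsub>M\<^esub> free_extension R M f t" .
next
  fix t u assume t: "t \<in> carrier (free_module R Z)" and u: "u \<in> carrier (free_module R Z)"
  let ?S = "{x. t x \<noteq> \<zero>} \<union> {x. u x \<noteq> \<zero>}"
  have S: "finite ?S" "?S \<subseteq> Z" and tc: "t x \<in> carrier R" and uc: "u x \<in> carrier R" for x
    using t u by (auto simp: R.mem_free_module)
  have tu: "t \<oplus>\<^bsub>free_module R Z\<^esub> u \<in> carrier (free_module R Z)"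
    by (rule abelian_monoid.a_closed[OF abelian_group.axioms(1)[OF module.axioms(2)[OF R.free_module]] t u])
  have "free_extension R M f (t \<oplus>\<^bsub>free_module R Z\<^esub> u) =
      (\<Oplus>\<^bsub>M\<^esub>x\<in>?S. (t \<oplus>\<^bsub>free_module R Z\<^esub> u) x \<odot>\<^bsub>M\<^esub> f x)"
    using tu f S by (intro free_extension_superset[of _ Z]) auto
  also have "\<dots> = (\<Oplus>\<^bsub>M\<^esub>x\<in>?S. t x \<odot>\<^bsub>M\<^esub> f x \<oplus>\<^bsub>M\<^esub> u x \<odot>\<^bsub>M\<^esub> f x)"
    using tc uc f S by (intro M.finsum_cong') (auto simp: smult_l_distr Pi_iff subset_iff)
  also have "\<dots> = (\<Oplus>\<^bsub>M\<^esub>x\<in>?S. t x \<odot>\<^bsub>M\<^esub> f x) \<oplus>\<^bsub>M\<^esub> (\<Oplus>\<^bsub>M\<^esub>x\<in>?S. u x \<odot>\<^bsub>M\<^esub> f x)"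
    using tc uc f S by (intro M.finsum_addf) (auto simp: Pi_iff subset_iff)
  also have "(\<Oplus>\<^bsub>M\<^esub>x\<in>?S. t x \<odot>\<^bsub>M\<^esub> f x) = free_extension R M f t"
    using t f S by (intro free_extension_superset[of _ Z, symmetric]) auto
  also have "(\<Oplus>\<^bsub>M\<^esub>x\<in>?S. u x \<odot>\<^bsub>M\<^esub> f x) = free_extension R M f u"
    using u f S by (intro free_extension_superset[of _ Z, symmetric]) auto
  finally show "free_extension R M f (t \<oplus>\<^bsub>free_module R Z\<^esub> u) =
      free_extension R M f t \<oplus>\<^bsub>M\<^esub> free_extension R M f u" .
qed

lemma free_extension_basis:
  assumes "f \<in> Z \<rightarrow> carrier M" "x \<in> Z"
  shows "free_extension R M f (free_basis R x) = f x"
proof -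
  have ext: "f x \<in> carrier M" using assms by auto
  have "free_extension R M f (free_basis R x) = (\<Oplus>\<^bsub>M\<^esub>y\<in>{x}. free_basis R x y \<odot>\<^bsub>M\<^esub> f y)"
    by (rule free_extension_superset[OF R.free_basis_closed[of x Z] assms(1)])
      (use assms(2) in \<open>auto simp: free_basis_def split: if_splits\<close>)
  also have "\<dots> = f x"
    using ext by (simp add: free_basis_def)
  finally show ?thesis .
qed

end


section \<open>Tensor products\<close>

definition bilinear_maps ::
    "('k, 'r) ring_scheme \<Rightarrow> ('k, 'a, 'm) module_scheme \<Rightarrow> ('k, 'b, 'n) module_scheme
      \<Rightarrow> ('k, 'c, 'p) module_scheme \<Rightarrow> ('a \<Rightarrow> 'b \<Rightarrow> 'c) set"
  where "bilinear_maps k M N P =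
    {f. (\<forall>n\<in>carrier N. (\<lambda>m. f m n) \<in> linear_maps k M P) \<and>
        (\<forall>m\<in>carrier M. f m \<in> linear_maps k N P)}"

lemma bilinear_mapsI:
  assumes "\<And>n. n \<in> carrier N \<Longrightarrow> (\<lambda>m. f m n) \<in> linear_maps k M P"
    and "\<And>m. m \<in> carrier M \<Longrightarrow> f m \<in> linear_maps k N P"
  shows "f \<in> bilinear_maps k M N P"
  using assms unfolding bilinear_maps_def by blast

lemma bilinear_maps_left: "\<lbrakk>f \<in> bilinear_maps k M N P; n \<in> carrier N\<rbrakk> \<Longrightarrow> (\<lambda>m. f m n) \<in> linear_maps k M P"
  unfolding bilinear_maps_def by blast

lemma bilinear_maps_right: "\<lbrakk>f \<in> bilinear_maps k M N P; m \<in> carrier M\<rbrakk> \<Longrightarrow> f m \<in> linear_maps k N P"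
  unfolding bilinear_maps_def by blast

lemma bilinear_maps_closed:
  "\<lbrakk>f \<in> bilinear_maps k M N P; m \<in> carrier M; n \<in> carrier N\<rbrakk> \<Longrightarrow> f m n \<in> carrier P"
  by (rule linear_maps_closed[OF bilinear_maps_right])

locale tensor_pair = M: module k M + N: module k N
  for k :: "('k, 'r) ring_scheme" and M :: "('k, 'a, 'm) module_scheme"
    and N :: "('k, 'b, 'n) module_scheme"
begin

abbreviation F where "F \<equiv> free_module k (carrier M \<times> carrier N)"
abbreviation e where "e m n \<equiv> free_basis k (m, n)"
abbreviation T where "T \<equiv> tensor_module k M N"
abbreviation pure (infixl \<open>\<otimes>\<^sub>t\<close> 70) where "m \<otimes>\<^sub>t n \<equiv> pure_tensor k M N m n"

text \<open>
  The generators of \<^const>\<open>tensor_relations\<close>, named so that the quotient by their span can be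
  treated as an instance of \<open>quotient_by\<close>.
\<close>

definition relators where "relators =
  {e (m \<oplus>\<^bsub>M\<^esub> m') n \<ominus>\<^bsub>F\<^esub> (e m n \<oplus>\<^bsub>F\<^esub> e m' n) | m m' n.
     m \<in> carrier M \<and> m' \<in> carrier M \<and> n \<in> carrier N} \<union>
  {e m (n \<oplus>\<^bsub>N\<^esub> n') \<ominus>\<^bsub>F\<^esub> (e m n \<oplus>\<^bsub>F\<^esub> e m n') | m n n'.
     m \<in> carrier M \<and> n \<in> carrier N \<and> n' \<in> carrier N} \<union>
  {e (c \<odot>\<^bsub>M\<^esub> m) n \<ominus>\<^bsub>F\<^esub> c \<odot>\<^bsub>F\<^esub> e m n | c m n.
     c \<in> carrier k \<and> m \<in> carrier M \<and> n \<in> carrier N} \<union>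
  {e m (c \<odot>\<^bsub>N\<^esub> n) \<ominus>\<^bsub>F\<^esub> c \<odot>\<^bsub>F\<^esub> e m n | c m n.
     c \<in> carrier k \<and> m \<in> carrier M \<and> n \<in> carrier N}"

lemma tensor_relations_eq: "tensor_relations k M N = module_span k F relators"
  unfolding tensor_relations_def relators_def Let_def by simp

sublocale F: module k F by (rule M.R.free_module)

lemma e_closed [simp]: "\<lbrakk>m \<in> carrier M; n \<in> carrier N\<rbrakk> \<Longrightarrow> e m n \<in> carrier F"
  by (simp add: M.R.free_basis_closed)

lemma relators_closed: "relators \<subseteq> carrier F"
  unfolding relators_def
  by (auto simp del: free_module_simps intro!: F.M.minus_closed F.M.a_closed F.smult_closed)

sublocale T: quotient_by k F "tensor_relations k M N"
  by (intro quotient_by.intro quotient_by_axioms.intro F.module_axioms)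
    (simp add: tensor_relations_eq F.submodule_module_span relators_closed)

lemma tensor_module_eq: "T = quotient_module F (tensor_relations k M N)"
  by (simp add: tensor_module_def)

lemma tensor_module [simp, intro]: "module k T"
  unfolding tensor_module_eq by (rule T.quotient_module)

sublocale T: module k T by (rule tensor_module)

lemma pure_eq: "m \<otimes>\<^sub>t n = T.coset (e m n)"
  by (simp add: pure_tensor_def)

lemma coset_in_T: "t \<in> carrier F \<Longrightarrow> T.coset t \<in> carrier T"
  unfolding tensor_module_eq by (rule T.coset_closed)

lemma coset_T_add: "\<lbrakk>t \<in> carrier F; u \<in> carrier F\<rbrakk> \<Longrightarrow> T.coset t \<oplus>\<^bsub>T\<^esub> T.coset u = T.coset (t \<oplus>\<^bsub>F\<^esub> u)"
  unfolding tensor_module_eq by (rule T.coset_add)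

lemma coset_T_smult: "\<lbrakk>c \<in> carrier k; t \<in> carrier F\<rbrakk> \<Longrightarrow> c \<odot>\<^bsub>T\<^esub> T.coset t = T.coset (c \<odot>\<^bsub>F\<^esub> t)"
  unfolding tensor_module_eq by (rule T.coset_smult)

lemma coset_relator:
  assumes "t \<ominus>\<^bsub>F\<^esub> u \<in> relators" "t \<in> carrier F" "u \<in> carrier F"
  shows "T.coset t = T.coset u"
  using assms F.module_span_superset[of relators] T.coset_eq_iff
  unfolding tensor_relations_eq by blast

lemma pure_bilinear: "pure_tensor k M N \<in> bilinear_maps k M N T"
proof (intro bilinear_mapsI linear_mapsI)
  show "m \<otimes>\<^sub>t n \<in> carrier T" if "m \<in> carrier M" "n \<in> carrier N" for m n
    using that by (simp add: pure_eq coset_in_T)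
  then show "m \<otimes>\<^sub>t n \<in> carrier T" if "n \<in> carrier N" "m \<in> carrier M" for m n
    using that by simp
  show "(m \<oplus>\<^bsub>M\<^esub> m') \<otimes>\<^sub>t n = m \<otimes>\<^sub>t n \<oplus>\<^bsub>T\<^esub> m' \<otimes>\<^sub>t n"
    if "n \<in> carrier N" "m \<in> carrier M" "m' \<in> carrier M" for m m' n
    unfolding pure_eq using that
    by (simp only: coset_T_add e_closed, intro coset_relator)
      (auto simp: relators_def simp del: free_module_simps)
  show "m \<otimes>\<^sub>t (n \<oplus>\<^bsub>N\<^esub> n') = m \<otimes>\<^sub>t n \<oplus>\<^bsub>T\<^esub> m \<otimes>\<^sub>t n'"
    if "m \<in> carrier M" "n \<in> carrier N" "n' \<in> carrier N" for m n n'
    unfolding pure_eq using that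
    by (simp only: coset_T_add e_closed, intro coset_relator)
      (auto simp: relators_def simp del: free_module_simps)
  show "(c \<odot>\<^bsub>M\<^esub> m) \<otimes>\<^sub>t n = c \<odot>\<^bsub>T\<^esub> (m \<otimes>\<^sub>t n)"
    if "n \<in> carrier N" "c \<in> carrier k" "m \<in> carrier M" for c m n
    unfolding pure_eq using that
    by (simp only: coset_T_smult e_closed, intro coset_relator)
      (auto simp: relators_def simp del: free_module_simps)
  show "m \<otimes>\<^sub>t (c \<odot>\<^bsub>N\<^esub> n) = c \<odot>\<^bsub>T\<^esub> (m \<otimes>\<^sub>t n)"
    if "m \<in> carrier M" "c \<in> carrier k" "n \<in> carrier N" for c m n
    unfolding pure_eq using that
    by (simp only: coset_T_smult e_closed, intro coset_relator)
      (auto simp: relators_def simp del: free_module_simps)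
qed

lemma pure_closed [simp, intro]: "\<lbrakk>m \<in> carrier M; n \<in> carrier N\<rbrakk> \<Longrightarrow> m \<otimes>\<^sub>t n \<in> carrier T"
  by (rule bilinear_maps_closed[OF pure_bilinear])

lemma pure_left: "n \<in> carrier N \<Longrightarrow> (\<lambda>m. m \<otimes>\<^sub>t n) \<in> linear_maps k M T"
  by (rule bilinear_maps_left[OF pure_bilinear])

lemma pure_right: "m \<in> carrier M \<Longrightarrow> (\<lambda>n. m \<otimes>\<^sub>t n) \<in> linear_maps k N T"
  by (rule bilinear_maps_right[OF pure_bilinear])

lemmas pure_add_left = linear_maps_add[OF pure_left]
lemmas pure_smult_left = linear_maps_smult[OF pure_left]
lemmas pure_add_right = linear_maps_add[OF pure_right]
lemmas pure_smult_right = linear_maps_smult[OF pure_right]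

text \<open>
  Neither zero nor scalar multiples need a case of their own: \<open>0 = 0 \<otimes> 0\<close>, and scalars are absorbed
  into the first factor of a pure tensor.
\<close>

lemma tensor_induct [consumes 1, case_names pure add]:
  assumes t: "t \<in> carrier T"
    and pure: "\<And>m n. \<lbrakk>m \<in> carrier M; n \<in> carrier N\<rbrakk> \<Longrightarrow> P (m \<otimes>\<^sub>t n)"
    and add: "\<And>t u. \<lbrakk>t \<in> carrier T; u \<in> carrier T; P t; P u\<rbrakk> \<Longrightarrow> P (t \<oplus>\<^bsub>T\<^esub> u)"
  shows "P t"
proof -
  have "P (T.coset r)" if "r \<in> carrier F" for r
    using that
  proof (induction rule: M.R.free_module_induct)
    case zero
    have "T.coset \<zero>\<^bsub>F\<^esub> = \<zero>\<^bsub>T\<^esub>"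
      unfolding tensor_module_eq by (simp only: T.zero_coset)
    also have "\<dots> = \<zero>\<^bsub>M\<^esub> \<otimes>\<^sub>t \<zero>\<^bsub>N\<^esub>"
      using linear_maps_zero[OF M.module_axioms tensor_module pure_left[of "\<zero>\<^bsub>N\<^esub>"]] by simp
    finally show ?case
      using pure[of "\<zero>\<^bsub>M\<^esub>" "\<zero>\<^bsub>N\<^esub>"] by simp
  next
    case (add c x r)
    then obtain m n where x: "x = (m, n)" "m \<in> carrier M" "n \<in> carrier N"
      by blast
    have "T.coset (c \<odot>\<^bsub>F\<^esub> e m n \<oplus>\<^bsub>F\<^esub> r) = (c \<odot>\<^bsub>M\<^esub> m) \<otimes>\<^sub>t n \<oplus>\<^bsub>T\<^esub> T.coset r"
    proof -
      have "(c \<odot>\<^bsub>M\<^esub> m) \<otimes>\<^sub>t n = c \<odot>\<^bsub>T\<^esub> (m \<otimes>\<^sub>t n)"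
        using add x by (simp add: pure_smult_left)
      also have "\<dots> = T.coset (c \<odot>\<^bsub>F\<^esub> e m n)"
        using add x by (simp only: pure_eq coset_T_smult e_closed)
      finally show ?thesis
        using add x by (simp only: coset_T_add e_closed F.smult_closed)
    qed
    then show ?case
      using add x assms(2,3) coset_in_T
      by (auto simp del: free_module_simps)
  qed
  then show ?thesis
    using t unfolding tensor_module_eq by (auto elim: T.coset_exhaust)
qed

lemma tensor_ext:
  assumes "f \<in> linear_maps k T P" "g \<in> linear_maps k T P"
    and "\<And>m n. \<lbrakk>m \<in> carrier M; n \<in> carrier N\<rbrakk> \<Longrightarrow> f (m \<otimes>\<^sub>t n) = g (m \<otimes>\<^sub>t n)"
    and "t \<in> carrier T"
  shows "f t = g t"
  using assms(4)
  by (induction rule: tensor_induct)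
    (simp_all add: assms(3) linear_maps_add[OF assms(1)] linear_maps_add[OF assms(2)])

context
  fixes P :: "('k, 'c, 'p) module_scheme" and f :: "'a \<Rightarrow> 'b \<Rightarrow> 'c"
  assumes P: "module k P" and f: "f \<in> bilinear_maps k M N P"
begin

interpretation P: module k P by (rule P)

abbreviation (input) ext where "ext \<equiv> free_extension k P (\<lambda>p. f (fst p) (snd p))"

lemma extension_linear: "ext \<in> linear_maps k F P"
  by (rule P.free_extension_linear) (use bilinear_maps_closed[OF f] in auto)

lemma extension_basis: "\<lbrakk>m \<in> carrier M; n \<in> carrier N\<rbrakk> \<Longrightarrow> ext (e m n) = f m n"
  by (subst P.free_extension_basis[of _ "carrier M \<times> carrier N"]) (use bilinear_maps_closed[OF f] in auto)

text \<open>
  This is where bilinearity of \<open>f\<close> enters: it says exactly that the linear extension of \<open>f\<close> kills the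
  relators, and the kernel is a submodule.
\<close>

lemma extension_relations: "t \<in> tensor_relations k M N \<Longrightarrow> ext t = \<zero>\<^bsub>P\<^esub>"
proof -
  have "submodule {t \<in> carrier F. ext t \<in> {\<zero>\<^bsub>P\<^esub>}} k F"
    using F.module_axioms P extension_linear P.zero_submodule by (rule linear_maps_preimage)
  moreover have "relators \<subseteq> {t \<in> carrier F. ext t \<in> {\<zero>\<^bsub>P\<^esub>}}"
  proof -
    have diff: "t \<ominus>\<^bsub>F\<^esub> u \<in> {t \<in> carrier F. ext t \<in> {\<zero>\<^bsub>P\<^esub>}}"
      if "t \<in> carrier F" "u \<in> carrier F" "ext t = ext u" for t u
      using that linear_maps_closed[OF extension_linear]
      by (simp add: linear_maps_minus[OF F.module_axioms P extension_linear] P.minus_eq_zero_iff F.M.minus_closed)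
    note fl = bilinear_maps_left[OF f] and fr = bilinear_maps_right[OF f]
    show ?thesis
      unfolding relators_def
      by (intro Un_least subsetI; elim CollectE exE conjE; hypsubst; intro diff)
        (simp_all only: linear_maps_add[OF extension_linear] linear_maps_smult[OF extension_linear] extension_basis
          linear_maps_add[OF fl] linear_maps_add[OF fr] linear_maps_smult[OF fl] linear_maps_smult[OF fr]
          e_closed F.M.a_closed F.smult_closed M.M.a_closed N.M.a_closed M.smult_closed N.smult_closed)
  qed
  ultimately show "t \<in> tensor_relations k M N \<Longrightarrow> ext t = \<zero>\<^bsub>P\<^esub>"
    unfolding tensor_relations_eq using F.module_span_least by blast
qed

lemma tensor_lift_coset:
  assumes t: "t \<in> carrier F"
  shows "tensor_lift k P f (T.coset t) = ext t"
proof -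
  have "ext u = ext t" if u: "u \<in> T.coset t" for u
  proof -
    obtain r where r: "r \<in> tensor_relations k M N" "u = r \<oplus>\<^bsub>F\<^esub> t"
      using u unfolding a_r_coset_def' by blast
    have "ext u = ext r \<oplus>\<^bsub>P\<^esub> ext t"
      unfolding r(2) using T.a_Hcarr[OF r(1)] t by (rule linear_maps_add[OF extension_linear])
    also have "\<dots> = ext t"
      unfolding extension_relations[OF r(1)] using linear_maps_closed[OF extension_linear t] by (rule P.M.l_zero)
    finally show ?thesis .
  qed
  moreover have "t \<in> T.coset t"
    using t by (rule T.a_rcos_self)
  ultimately have "ext ` T.coset t = {ext t}"
    by blast
  then show ?thesis
    unfolding tensor_lift_def free_extension_def by simp
qed

lemma tensor_lift_linear: "tensor_lift k P f \<in> linear_maps k T P"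
proof (rule linear_mapsI)
  fix t u assume "t \<in> carrier T" "u \<in> carrier T"
  then obtain r s where "r \<in> carrier F" "t = T.coset r" "s \<in> carrier F" "u = T.coset s"
    unfolding tensor_module_eq by (metis T.coset_exhaust)
  then show "tensor_lift k P f (t \<oplus>\<^bsub>T\<^esub> u) = tensor_lift k P f t \<oplus>\<^bsub>P\<^esub> tensor_lift k P f u"
    by (simp add: coset_T_add tensor_lift_coset linear_maps_add[OF extension_linear] F.M.a_closed del: free_module_simps)
next
  fix t assume "t \<in> carrier T"
  then obtain r where r: "r \<in> carrier F" "t = T.coset r"
    unfolding tensor_module_eq by (metis T.coset_exhaust)
  then show "tensor_lift k P f t \<in> carrier P"
    by (simp add: tensor_lift_coset linear_maps_closed[OF extension_linear])
  show "tensor_lift k P f (c \<odot>\<^bsub>T\<^esub> t) = c \<odot>\<^bsub>P\<^esub> tensor_lift k P f t" if "c \<in> carrier k" for c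
    using that r
    by (simp add: coset_T_smult tensor_lift_coset linear_maps_smult[OF extension_linear] F.smult_closed del: free_module_simps)
qed

lemma tensor_lift_pure: "\<lbrakk>m \<in> carrier M; n \<in> carrier N\<rbrakk> \<Longrightarrow> tensor_lift k P f (m \<otimes>\<^sub>t n) = f m n"
  by (simp add: pure_eq tensor_lift_coset extension_basis)

end

end

context tensor_pair begin

text \<open>
  A trilinear map \<open>M \<times> N \<times> L \<rightarrow> Q\<close> induces a bilinear map \<open>(M \<otimes> N) \<times> L \<rightarrow> Q\<close>.  The associator and
  the product of two algebras are nested lifts of this shape.
\<close>

lemma tensor_lift_bilinear:
  assumes L: "module k L" and Q: "module k Q"
    and MN: "\<And>p. p \<in> carrier L \<Longrightarrow> (\<lambda>m n. h m n p) \<in> bilinear_maps k M N Q"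
    and P: "\<And>m n. \<lbrakk>m \<in> carrier M; n \<in> carrier N\<rbrakk> \<Longrightarrow> h m n \<in> linear_maps k L Q"
  shows "(\<lambda>t p. tensor_lift k Q (\<lambda>m n. h m n p) t) \<in> bilinear_maps k T L Q"
proof -
  interpret L: module k L by (rule L)
  interpret Q: module k Q by (rule Q)
  note lin = tensor_lift_linear[OF Q MN] and pure = tensor_lift_pure[OF Q MN]
  show ?thesis
  proof (rule bilinear_mapsI)
    show "(\<lambda>t. tensor_lift k Q (\<lambda>m n. h m n p) t) \<in> linear_maps k T Q" if "p \<in> carrier L" for p
      using lin[OF that] .
    fix t assume t: "t \<in> carrier T"
    show "(\<lambda>p. tensor_lift k Q (\<lambda>m n. h m n p) t) \<in> linear_maps k L Q"
    proof (rule linear_mapsI)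
      show "tensor_lift k Q (\<lambda>m n. h m n p) t \<in> carrier Q" if "p \<in> carrier L" for p
        using linear_maps_closed[OF lin[OF that] t] .
      show "tensor_lift k Q (\<lambda>m n. h m n (p \<oplus>\<^bsub>L\<^esub> q)) t =
          tensor_lift k Q (\<lambda>m n. h m n p) t \<oplus>\<^bsub>Q\<^esub> tensor_lift k Q (\<lambda>m n. h m n q) t"
        if "p \<in> carrier L" "q \<in> carrier L" for p q
        by (rule tensor_ext[OF lin linear_maps_sum[OF Q lin lin] _ t])
          (simp_all add: that pure linear_maps_add[OF P])
      show "tensor_lift k Q (\<lambda>m n. h m n (c \<odot>\<^bsub>L\<^esub> p)) t = c \<odot>\<^bsub>Q\<^esub> tensor_lift k Q (\<lambda>m n. h m n p) t"
        if "c \<in> carrier k" "p \<in> carrier L" for c p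
        by (rule tensor_ext[OF lin linear_maps_scaled[OF Q _ lin] _ t])
          (simp_all add: that pure linear_maps_smult[OF P])
    qed
  qed
qed

context
  fixes M' :: "('k, 'c, 'p) module_scheme" and N' :: "('k, 'd, 'q) module_scheme" and f g
  assumes M': "module k M'" and N': "module k N'"
    and f: "f \<in> linear_maps k M M'" and g: "g \<in> linear_maps k N N'"
begin

interpretation T': tensor_pair k M' N'
  by (intro tensor_pair.intro M' N')

lemma tensor_map_bilinear:
  "(\<lambda>m n. pure_tensor k M' N' (f m) (g n)) \<in> bilinear_maps k M N (tensor_module k M' N')"
  by (intro bilinear_mapsI linear_maps_compose[OF f T'.pure_left] linear_maps_compose[OF g T'.pure_right])
    (auto intro: linear_maps_closed[OF f] linear_maps_closed[OF g])

lemma tensor_map_linear: "tensor_map k M' N' f g \<in> linear_maps k T (tensor_module k M' N')"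
  unfolding tensor_map_def by (rule tensor_lift_linear[OF T'.tensor_module tensor_map_bilinear])

lemma tensor_map_pure:
  "\<lbrakk>m \<in> carrier M; n \<in> carrier N\<rbrakk> \<Longrightarrow> tensor_map k M' N' f g (m \<otimes>\<^sub>t n) = pure_tensor k M' N' (f m) (g n)"
  unfolding tensor_map_def by (rule tensor_lift_pure[OF T'.tensor_module tensor_map_bilinear])

end

end

section \<open>Subspaces of tensor products\<close>

context tensor_pair begin

context
  fixes U V
  assumes U: "submodule U k M" and V: "submodule V k N"
begin

interpretation UV: tensor_pair k "M\<lparr>carrier := U\<rparr>" "N\<lparr>carrier := V\<rparr>"
  by (intro tensor_pair.intro submodule.submodule_is_module U V M.module_axioms N.module_axioms)

lemma inclusion_linear:
  "id \<in> linear_maps k (M\<lparr>carrier := U\<rparr>) M" "id \<in> linear_maps k (N\<lparr>carrier := V\<rparr>) N"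
  using M.submoduleE(1)[OF U] N.submoduleE(1)[OF V] by (auto intro!: linear_mapsI)

lemma tensor_subspace_submodule: "submodule (tensor_subspace k M N U V) k T"
  unfolding tensor_subspace_def
  by (intro linear_maps_image UV.tensor_module tensor_module
      UV.tensor_map_linear[OF M.module_axioms N.module_axioms inclusion_linear])

lemma tensor_subspace_pure:
  assumes "u \<in> U" "v \<in> V"
  shows "u \<otimes>\<^sub>t v \<in> tensor_subspace k M N U V"
  unfolding tensor_subspace_def
  by (rule image_eqI[of _ _ "pure_tensor k (M\<lparr>carrier := U\<rparr>) (N\<lparr>carrier := V\<rparr>) u v"])
    (use assms in \<open>auto simp: UV.tensor_map_pure[OF M.module_axioms N.module_axioms inclusion_linear]\<close>)

text \<open>
  The image of \<open>U \<otimes> V\<close> in \<open>M \<otimes> N\<close> is generated additively by the pure tensors of elements of \<open>U\<close> and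
  \<open>V\<close>.  Through this rule the tensor product of the restricted modules never has to be mentioned
  again.
\<close>

lemma tensor_subspace_induct [consumes 1, case_names pure add]:
  assumes t: "t \<in> tensor_subspace k M N U V"
    and pure: "\<And>u v. \<lbrakk>u \<in> U; v \<in> V\<rbrakk> \<Longrightarrow> P (u \<otimes>\<^sub>t v)"
    and add: "\<And>t s. \<lbrakk>t \<in> tensor_subspace k M N U V; s \<in> tensor_subspace k M N U V; P t; P s\<rbrakk> \<Longrightarrow> P (t \<oplus>\<^bsub>T\<^esub> s)"
  shows "P t"
proof -
  define j where "j = tensor_map k M N id id"
  note j = UV.tensor_map_linear[OF M.module_axioms N.module_axioms inclusion_linear, folded j_def]
    UV.tensor_map_pure[OF M.module_axioms N.module_axioms inclusion_linear, folded j_def]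
  have "P (j r)" if "r \<in> carrier (tensor_module k (M\<lparr>carrier := U\<rparr>) (N\<lparr>carrier := V\<rparr>))" for r
    using that
  proof (induction rule: UV.tensor_induct)
    case (pure m n)
    then show ?case using assms(2) j(2) by simp
  next
    case (add r s)
    then show ?case
      using assms(3)[of "j r" "j s"] by (simp add: linear_maps_add[OF j(1)] tensor_subspace_def j_def[symmetric])
  qed
  then show ?thesis
    using t unfolding tensor_subspace_def j_def by blast
qed

lemma tensor_subspace_subset: "tensor_subspace k M N U V \<subseteq> carrier T"
  using T.submoduleE(1)[OF tensor_subspace_submodule] .

lemma tensor_subspace_leI:
  assumes "submodule X k T" "\<And>u v. \<lbrakk>u \<in> U; v \<in> V\<rbrakk> \<Longrightarrow> u \<otimes>\<^sub>t v \<in> X"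
  shows "tensor_subspace k M N U V \<subseteq> X"
proof
  fix t assume "t \<in> tensor_subspace k M N U V"
  then show "t \<in> X"
    by (induction rule: tensor_subspace_induct) (use assms T.submoduleE(5)[OF assms(1)] in auto)
qed

end

lemma tensor_subspace_mono:
  assumes "submodule U k M" "submodule V k N" "submodule U' k M" "submodule V' k N" "U \<subseteq> U'" "V \<subseteq> V'"
  shows "tensor_subspace k M N U V \<subseteq> tensor_subspace k M N U' V'"
  by (rule tensor_subspace_leI[OF assms(1,2) tensor_subspace_submodule[OF assms(3,4)]])
    (use assms in \<open>auto intro: tensor_subspace_pure\<close>)

lemma tensor_subspace_carrier: "tensor_subspace k M N (carrier M) (carrier N) = carrier T"
proof
  show "carrier T \<subseteq> tensor_subspace k M N (carrier M) (carrier N)"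
  proof
    note c = M.carrier_is_submodule N.carrier_is_submodule
    fix t assume "t \<in> carrier T"
    then show "t \<in> tensor_subspace k M N (carrier M) (carrier N)"
      by (induction rule: tensor_induct)
        (auto intro: tensor_subspace_pure[OF c] T.submoduleE(5)[OF tensor_subspace_submodule[OF c]])
  qed
qed (rule tensor_subspace_subset[OF M.carrier_is_submodule N.carrier_is_submodule])

end


section \<open>Functionals\<close>

text \<open>
  The ground ring as a module over itself, so that functionals are linear maps like any others.
\<close>

definition regular_module :: "('k, 'r) ring_scheme \<Rightarrow> ('k, 'k) module"
  where "regular_module k =
    \<lparr>carrier = carrier k, mult = mult k, one = one k, zero = zero k, add = add k, smult = mult k\<rparr>"

lemma regular_module_simps [simp]:
  "carrier (regular_module k) = carrier k" "zero (regular_module k) = zero k"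
  "add (regular_module k) = add k" "smult (regular_module k) = mult k"
  by (simp_all add: regular_module_def)

lemma (in cring) regular_module: "module R (regular_module R)"
proof (rule moduleI)
  show "abelian_group (regular_module R)"
  proof (rule abelian_groupI)
    show "\<exists>y\<in>carrier (regular_module R). y \<oplus>\<^bsub>regular_module R\<^esub> x = \<zero>\<^bsub>regular_module R\<^esub>"
      if "x \<in> carrier (regular_module R)" for x
      using that l_neg by (auto intro!: bexI[of _ "\<ominus> x"])
  qed (auto simp: a_ac)
qed (auto simp: cring_axioms l_distr r_distr m_assoc)

abbreviation functionals where "functionals k M \<equiv> linear_maps k M (regular_module k)"

context module begin

lemma submodule_sum_line:
  assumes W: "submodule W R M" and x: "x \<in> carrier M"
  shows "submodule {w \<oplus>\<^bsub>M\<^esub> c \<odot>\<^bsub>M\<^esub> x | w c. w \<in> W \<and> c \<in> carrier R} R M" (is "submodule ?X R M")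
proof (rule submoduleI)
  note WM = subsetD[OF submoduleE(1)[OF W]]
  show "?X \<subseteq> carrier M" using WM x by auto
  show "\<zero>\<^bsub>M\<^esub> \<in> ?X"
    using submodule_zero[OF W] x by (force intro: exI[of _ "\<zero>\<^bsub>M\<^esub>"] exI[of _ \<zero>])
  fix a assume "a \<in> ?X"
  then obtain w c where a: "a = w \<oplus>\<^bsub>M\<^esub> c \<odot>\<^bsub>M\<^esub> x" "w \<in> W" "c \<in> carrier R" by blast
  have "\<ominus>\<^bsub>M\<^esub> a = \<ominus>\<^bsub>M\<^esub> w \<oplus>\<^bsub>M\<^esub> (\<ominus> c) \<odot>\<^bsub>M\<^esub> x"
    using a x WM by (simp add: M.minus_add smult_l_minus)
  then show "\<ominus>\<^bsub>M\<^esub> a \<in> ?X"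
    using a submoduleE(3)[OF W] by blast
  show "d \<odot>\<^bsub>M\<^esub> a \<in> ?X" if d: "d \<in> carrier R" for d
  proof -
    have "d \<odot>\<^bsub>M\<^esub> a = d \<odot>\<^bsub>M\<^esub> w \<oplus>\<^bsub>M\<^esub> (d \<otimes> c) \<odot>\<^bsub>M\<^esub> x"
      using a x WM d by (simp add: smult_r_distr smult_assoc1)
    then show ?thesis
      using a d submoduleE(4)[OF W] by blast
  qed
  fix b assume "b \<in> ?X"
  then obtain v d where b: "b = v \<oplus>\<^bsub>M\<^esub> d \<odot>\<^bsub>M\<^esub> x" "v \<in> W" "d \<in> carrier R" by blast
  have "a \<oplus>\<^bsub>M\<^esub> b = (w \<oplus>\<^bsub>M\<^esub> v) \<oplus>\<^bsub>M\<^esub> (c \<oplus> d) \<odot>\<^bsub>M\<^esub> x"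
    using a b x WM by (simp add: smult_l_distr M.a_ac)
  then show "a \<oplus>\<^bsub>M\<^esub> b \<in> ?X"
    using a b submoduleE(5)[OF W] by blast
qed

text \<open>
  A maximal subspace \<open>X\<close> among those that contain \<open>W\<close> but not \<open>v\<close> is a complement of the line
  spanned by \<open>v\<close>: if \<open>x \<notin> X\<close>, then maximality puts \<open>v\<close> into \<open>X + k x\<close>, with a nonzero coefficient
  of \<open>x\<close>, which can be inverted.  The coordinate along \<open>v\<close> is the required functional.
\<close>

lemma functional_separating:
  assumes "field R" and W: "submodule W R M" and v: "v \<in> carrier M" "v \<notin> W"
  obtains f where "f \<in> functionals R M" "\<And>w. w \<in> W \<Longrightarrow> f w = \<zero>" "f v = \<one>"
proof -
  interpret field R by fact
  let ?S = "{X. submodule X R M \<and> W \<subseteq> X \<and> v \<notin> X}"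
  have "\<exists>X\<in>?S. \<forall>Y\<in>?S. X \<subseteq> Y \<longrightarrow> Y = X"
  proof (rule subset_Zorn_nonempty)
    show "?S \<noteq> {}" using W v by blast
    fix C assume ne: "C \<noteq> {}" and C: "subset.chain ?S C"
    have Csub: "submodule X R M" if "X \<in> C" for X
      using that C unfolding subset.chain_def by blast
    have "submodule (\<Union>C) R M"
    proof (rule submoduleI)
      show "\<Union>C \<subseteq> carrier M" using Csub submoduleE(1) by blast
      show "\<zero>\<^bsub>M\<^esub> \<in> \<Union>C" using ne Csub submodule_zero by blast
      show "\<ominus>\<^bsub>M\<^esub> a \<in> \<Union>C" if "a \<in> \<Union>C" for a
        using that Csub submoduleE(3) by blast
      show "c \<odot>\<^bsub>M\<^esub> a \<in> \<Union>C" if "c \<in> carrier R" "a \<in> \<Union>C" for a c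
        using that Csub submoduleE(4) by blast
      fix a b assume "a \<in> \<Union>C" "b \<in> \<Union>C"
      then obtain X where "X \<in> C" "a \<in> X" "b \<in> X"
        using C unfolding subset.chain_def by blast
      then show "a \<oplus>\<^bsub>M\<^esub> b \<in> \<Union>C" using Csub submoduleE(5) by blast
    qed
    then show "\<Union>C \<in> ?S" using ne C unfolding subset.chain_def by blast
  qed
  then obtain X where XS: "X \<in> ?S" and Xmax: "\<forall>Y\<in>?S. X \<subseteq> Y \<longrightarrow> Y = X"
    by (rule bexE)
  then have X: "submodule X R M" "W \<subseteq> X" "v \<notin> X"
    by simp_all
  have max: "Y = X" if "submodule Y R M" "X \<subseteq> Y" "v \<notin> Y" for Y
    using bspec[OF Xmax, of Y] that X(2) by simp
  note XM = subsetD[OF submoduleE(1)[OF X(1)]]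
  \<comment> \<open>The line spanned by \<open>v\<close> meets \<open>X\<close> only in zero.\<close>
  have scale: "c = \<zero>" if c: "c \<in> carrier R" "c \<odot>\<^bsub>M\<^esub> v \<in> X" for c
  proof (rule ccontr)
    assume "c \<noteq> \<zero>"
    then have "c \<in> Units R" using c field_Units by blast
    then have "inv c \<odot>\<^bsub>M\<^esub> (c \<odot>\<^bsub>M\<^esub> v) = v" "inv c \<in> carrier R"
      using c v(1) by (simp_all add: smult_assoc1[symmetric])
    then show False
      using X submoduleE(4)[OF X(1) _ c(2)] by metis
  qed
  have ex: "\<exists>c w. c \<in> carrier R \<and> w \<in> X \<and> x = w \<oplus>\<^bsub>M\<^esub> c \<odot>\<^bsub>M\<^esub> v" if x: "x \<in> carrier M" for x
  proof (cases "x \<in> X")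
    case True
    then show ?thesis
      using x v by (intro exI[of _ \<zero>] exI[of _ x]) simp
  next
    case False
    let ?Y = "{w \<oplus>\<^bsub>M\<^esub> c \<odot>\<^bsub>M\<^esub> x | w c. w \<in> X \<and> c \<in> carrier R}"
    have "w \<in> ?Y" if "w \<in> X" for w
      using that x XM by (force intro: exI[of _ w] exI[of _ \<zero>])
    then have XY: "X \<subseteq> ?Y" by blast
    have "x \<in> ?Y"
      using x submodule_zero[OF X(1)] by (force intro: exI[of _ "\<zero>\<^bsub>M\<^esub>"] exI[of _ \<one>])
    then have "v \<in> ?Y"
      using max[OF submodule_sum_line[OF X(1) x] XY] False by blast
    then obtain w c where w: "v = w \<oplus>\<^bsub>M\<^esub> c \<odot>\<^bsub>M\<^esub> x" "w \<in> X" "c \<in> carrier R" by blast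
    have "c \<noteq> \<zero>"
      using w X(3) x XM by auto
    then have c: "inv c \<in> carrier R" "inv c \<otimes> c = \<one>"
      using w field_Units by auto
    have "x = inv c \<odot>\<^bsub>M\<^esub> (c \<odot>\<^bsub>M\<^esub> x)"
      using c w x by (simp add: smult_assoc1[symmetric])
    also have "c \<odot>\<^bsub>M\<^esub> x = \<ominus>\<^bsub>M\<^esub> w \<oplus>\<^bsub>M\<^esub> v"
      using w x XM[OF w(2)] by (simp add: M.r_neg1)
    also have "inv c \<odot>\<^bsub>M\<^esub> \<dots> = inv c \<odot>\<^bsub>M\<^esub> (\<ominus>\<^bsub>M\<^esub> w) \<oplus>\<^bsub>M\<^esub> inv c \<odot>\<^bsub>M\<^esub> v"
      using c v XM[OF w(2)] by (simp add: smult_r_distr)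
    finally show ?thesis
      using c(1) submoduleE(3,4)[OF X(1)] w(2) by blast
  qed
  have unique: "c = d"
    if c: "c \<in> carrier R" "w \<in> X" and d: "d \<in> carrier R" "u \<in> X"
      and eq: "w \<oplus>\<^bsub>M\<^esub> c \<odot>\<^bsub>M\<^esub> v = u \<oplus>\<^bsub>M\<^esub> d \<odot>\<^bsub>M\<^esub> v" for c d w u
  proof -
    have wu: "w \<in> carrier M" "u \<in> carrier M" using c d XM by auto
    have "c \<odot>\<^bsub>M\<^esub> v = \<ominus>\<^bsub>M\<^esub> w \<oplus>\<^bsub>M\<^esub> (u \<oplus>\<^bsub>M\<^esub> d \<odot>\<^bsub>M\<^esub> v)"
      using eq wu c v(1) by (metis M.r_neg1 smult_closed)
    then have "c \<odot>\<^bsub>M\<^esub> v \<oplus>\<^bsub>M\<^esub> (\<ominus> d) \<odot>\<^bsub>M\<^esub> v = \<ominus>\<^bsub>M\<^esub> w \<oplus>\<^bsub>M\<^esub> u"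
      using wu c d v(1) by (simp add: smult_l_minus M.a_assoc M.r_neg)
    then have "(c \<ominus> d) \<odot>\<^bsub>M\<^esub> v = \<ominus>\<^bsub>M\<^esub> w \<oplus>\<^bsub>M\<^esub> u"
      using c d v(1) by (simp add: a_minus_def smult_l_distr)
    then have "(c \<ominus> d) \<odot>\<^bsub>M\<^esub> v \<in> X"
      using c d submoduleE(3,5)[OF X(1)] by metis
    then have "c \<ominus> d = \<zero>"
      using scale[of "c \<ominus> d"] c d by simp
    then show ?thesis using c d by simp
  qed
  define f where "f x = (SOME c. c \<in> carrier R \<and> (\<exists>w\<in>X. x = w \<oplus>\<^bsub>M\<^esub> c \<odot>\<^bsub>M\<^esub> v))" for x
  have f: "f x \<in> carrier R \<and> (\<exists>w\<in>X. x = w \<oplus>\<^bsub>M\<^esub> f x \<odot>\<^bsub>M\<^esub> v)" if "x \<in> carrier M" for x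
    unfolding f_def by (rule someI_ex) (use ex[OF that] in blast)
  have f_eq: "f (w \<oplus>\<^bsub>M\<^esub> c \<odot>\<^bsub>M\<^esub> v) = c" if "c \<in> carrier R" "w \<in> X" for c w
    using unique[of "f (w \<oplus>\<^bsub>M\<^esub> c \<odot>\<^bsub>M\<^esub> v)" _ c w] f[of "w \<oplus>\<^bsub>M\<^esub> c \<odot>\<^bsub>M\<^esub> v"] that XM v(1)
    by (metis M.a_closed smult_closed)
  have "f \<in> functionals R M"
  proof (rule linear_mapsI)
    show "f x \<in> carrier (regular_module R)" if "x \<in> carrier M" for x using f[OF that] by simp
    fix x assume "x \<in> carrier M"
    then obtain w c where x: "x = w \<oplus>\<^bsub>M\<^esub> c \<odot>\<^bsub>M\<^esub> v" "w \<in> X" "c \<in> carrier R" using ex by blast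
    show "f (d \<odot>\<^bsub>M\<^esub> x) = d \<odot>\<^bsub>regular_module R\<^esub> f x" if "d \<in> carrier R" for d
    proof -
      have "d \<odot>\<^bsub>M\<^esub> x = d \<odot>\<^bsub>M\<^esub> w \<oplus>\<^bsub>M\<^esub> (d \<otimes> c) \<odot>\<^bsub>M\<^esub> v"
        using that x v XM by (simp add: smult_r_distr smult_assoc1)
      then have "f (d \<odot>\<^bsub>M\<^esub> x) = d \<otimes> c"
        using that x submoduleE(4)[OF X(1)] by (simp add: f_eq)
      then show ?thesis using x by (simp add: f_eq)
    qed
    fix y assume "y \<in> carrier M"
    then obtain u d where y: "y = u \<oplus>\<^bsub>M\<^esub> d \<odot>\<^bsub>M\<^esub> v" "u \<in> X" "d \<in> carrier R" using ex by blast
    have "x \<oplus>\<^bsub>M\<^esub> y = (w \<oplus>\<^bsub>M\<^esub> u) \<oplus>\<^bsub>M\<^esub> (c \<oplus> d) \<odot>\<^bsub>M\<^esub> v"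
      using x y v XM by (simp add: smult_l_distr M.a_ac)
    then have "f (x \<oplus>\<^bsub>M\<^esub> y) = c \<oplus> d"
      using x y submoduleE(5)[OF X(1)] by (simp add: f_eq)
    then show "f (x \<oplus>\<^bsub>M\<^esub> y) = f x \<oplus>\<^bsub>regular_module R\<^esub> f y"
      using x y by (simp add: f_eq)
  qed
  moreover have "f w = \<zero>" if "w \<in> W" for w
    using f_eq[of \<zero> w] that X(2) XM[of w] v(1) by auto
  moreover have "f v = \<one>"
    using f_eq[of \<one> "\<zero>\<^bsub>M\<^esub>"] submodule_zero[OF X(1)] v(1) by simp
  ultimately show ?thesis by (rule that)
qed

end


section \<open>Slices\<close>

text \<open>
  The map \<open>f \<otimes> id\<close>, with values in \<open>N\<close> after the identification of \<open>k \<otimes> N\<close> with \<open>N\<close>.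
\<close>

definition slice ::
    "('k, 'r) ring_scheme \<Rightarrow> ('k, 'b, 'n) module_scheme \<Rightarrow> ('a \<Rightarrow> 'k) \<Rightarrow> ('a \<times> 'b \<Rightarrow> 'k) set \<Rightarrow> 'b"
  where "slice k N f = tensor_lift k N (\<lambda>m n. f m \<odot>\<^bsub>N\<^esub> n)"

context tensor_pair begin

lemma slice_bilinear:
  assumes f: "f \<in> functionals k M"
  shows "(\<lambda>m n. f m \<odot>\<^bsub>N\<^esub> n) \<in> bilinear_maps k M N N"
proof -
  have fk: "f m \<in> carrier k" if "m \<in> carrier M" for m
    using linear_maps_closed[OF f that] by simp
  show ?thesis
  proof (intro bilinear_mapsI linear_mapsI)
    show "f m \<odot>\<^bsub>N\<^esub> (c \<odot>\<^bsub>N\<^esub> n) = c \<odot>\<^bsub>N\<^esub> (f m \<odot>\<^bsub>N\<^esub> n)"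
      if "m \<in> carrier M" "c \<in> carrier k" "n \<in> carrier N" for m c n
      using that fk[OF that(1)] by (metis N.smult_assoc1 M.R.m_comm)
  qed (simp_all add: fk linear_maps_add[OF f] linear_maps_smult[OF f] N.smult_l_distr N.smult_r_distr
      N.smult_assoc1)
qed

lemma slice_linear: "f \<in> functionals k M \<Longrightarrow> slice k N f \<in> linear_maps k T N"
  unfolding slice_def by (rule tensor_lift_linear[OF N.module_axioms slice_bilinear])

lemma slice_pure:
  "\<lbrakk>f \<in> functionals k M; m \<in> carrier M; n \<in> carrier N\<rbrakk> \<Longrightarrow> slice k N f (m \<otimes>\<^sub>t n) = f m \<odot>\<^bsub>N\<^esub> n"
  unfolding slice_def by (rule tensor_lift_pure[OF N.module_axioms slice_bilinear])

lemma slice_subspace: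
  assumes V: "submodule V k N" and f: "f \<in> functionals k M"
    and t: "t \<in> tensor_subspace k M N (carrier M) V"
  shows "slice k N f t \<in> V"
proof -
  have "tensor_subspace k M N (carrier M) V \<subseteq> {t \<in> carrier T. slice k N f t \<in> V}"
    by (rule tensor_subspace_leI[OF M.carrier_is_submodule V
          linear_maps_preimage[OF tensor_module N.module_axioms slice_linear[OF f] V]])
      (use N.submoduleE(1,4)[OF V] linear_maps_closed[OF f] in \<open>auto simp: slice_pure[OF f] subset_iff\<close>)
  then show ?thesis using t by blast
qed

lemma tensor_finite_span:
  assumes "t \<in> carrier T"
  shows "\<exists>X. finite X \<and> X \<subseteq> carrier M \<and> t \<in> tensor_subspace k M N (module_span k M X) (carrier N)"
  using assms
proof (induction rule: tensor_induct)
  case (pure m n)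
  then show ?case
    by (intro exI[of _ "{m}"])
      (auto intro!: tensor_subspace_pure M.submodule_module_span N.carrier_is_submodule
        M.module_span_superset[THEN subsetD])
next
  case (add t u)
  then obtain X Y where X: "finite X" "X \<subseteq> carrier M"
      "t \<in> tensor_subspace k M N (module_span k M X) (carrier N)"
    and Y: "finite Y" "Y \<subseteq> carrier M" "u \<in> tensor_subspace k M N (module_span k M Y) (carrier N)"
    by blast
  let ?S = "\<lambda>X. tensor_subspace k M N (module_span k M X) (carrier N)"
  have "?S Z \<subseteq> ?S (X \<union> Y)" if Z: "Z \<subseteq> X \<union> Y" for Z
  proof (intro tensor_subspace_mono M.submodule_module_span N.carrier_is_submodule subset_refl)
    show "Z \<subseteq> carrier M" and XY: "X \<union> Y \<subseteq> carrier M"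
      using Z X Y by auto
    show "module_span k M Z \<subseteq> module_span k M (X \<union> Y)"
      using Z M.module_span_superset[of "X \<union> Y"]
      by (intro M.module_span_least M.submodule_module_span XY) blast
  qed
  then have "t \<in> ?S (X \<union> Y)" "u \<in> ?S (X \<union> Y)"
    using X Y by blast+
  then have "t \<oplus>\<^bsub>T\<^esub> u \<in> ?S (X \<union> Y)"
    using X Y by (intro T.submoduleE(5)[OF tensor_subspace_submodule]
        M.submodule_module_span N.carrier_is_submodule) auto
  then show ?case
    using X Y by (intro exI[of _ "X \<union> Y"]) auto
qed

text \<open>
  A tensor with first factors in the span of \<open>insert m X\<close> differs from one with first factors in the
  span of \<open>X\<close> by a single pure tensor \<open>m \<otimes> n\<close>, because \<open>(w + c m) \<otimes> n = w \<otimes> n + m \<otimes> c n\<close>.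
\<close>

lemma tensor_subspace_insert:
  assumes X: "X \<subseteq> carrier M" "m \<in> carrier M"
    and t: "t \<in> tensor_subspace k M N (module_span k M (insert m X)) (carrier N)"
  shows "\<exists>s\<in>tensor_subspace k M N (module_span k M X) (carrier N). \<exists>n\<in>carrier N. t = s \<oplus>\<^bsub>T\<^esub> m \<otimes>\<^sub>t n"
proof -
  let ?S = "tensor_subspace k M N (module_span k M X) (carrier N)"
  have sX: "submodule (module_span k M X) k M" and smX: "submodule (module_span k M (insert m X)) k M"
    using X by (auto intro: M.submodule_module_span)
  note S = tensor_subspace_submodule[OF sX N.carrier_is_submodule]
  note ST = subsetD[OF T.submoduleE(1)[OF S]]
  note XM = subsetD[OF M.submoduleE(1)[OF sX]]
  let ?L = "{w \<oplus>\<^bsub>M\<^esub> c \<odot>\<^bsub>M\<^esub> m | w c. w \<in> module_span k M X \<and> c \<in> carrier k}"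
  have "module_span k M (insert m X) \<subseteq> ?L"
  proof (rule M.module_span_least[OF M.submodule_sum_line[OF sX X(2)]])
    have "m \<in> ?L"
      using X M.submodule_zero[OF sX] by (force intro: exI[of _ "\<zero>\<^bsub>M\<^esub>"] exI[of _ "\<one>\<^bsub>k\<^esub>"])
    moreover have "x \<in> ?L" if "x \<in> X" for x
      using that X M.module_span_superset[of X] by (force intro: exI[of _ x] exI[of _ "\<zero>\<^bsub>k\<^esub>"])
    ultimately show "insert m X \<subseteq> ?L" by blast
  qed
  note L = subsetD[OF this]
  show ?thesis
    using t
  proof (induction rule: tensor_subspace_induct[OF smX N.carrier_is_submodule, consumes 1, case_names pure add])
    case (pure x n)
    then obtain w c where w: "x = w \<oplus>\<^bsub>M\<^esub> c \<odot>\<^bsub>M\<^esub> m" "w \<in> module_span k M X" "c \<in> carrier k"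
      using L by blast
    have "x \<otimes>\<^sub>t n = w \<otimes>\<^sub>t n \<oplus>\<^bsub>T\<^esub> m \<otimes>\<^sub>t (c \<odot>\<^bsub>N\<^esub> n)"
      using w pure X XM by (simp add: pure_add_left pure_smult_left pure_smult_right)
    then show ?case
      using w pure tensor_subspace_pure[OF sX N.carrier_is_submodule, of w n] by blast
  next
    case (add t u)
    then obtain s n r n' where
      s: "s \<in> ?S" "n \<in> carrier N" "t = s \<oplus>\<^bsub>T\<^esub> m \<otimes>\<^sub>t n" and
      r: "r \<in> ?S" "n' \<in> carrier N" "u = r \<oplus>\<^bsub>T\<^esub> m \<otimes>\<^sub>t n'"
      by blast
    have "t \<oplus>\<^bsub>T\<^esub> u = (s \<oplus>\<^bsub>T\<^esub> r) \<oplus>\<^bsub>T\<^esub> m \<otimes>\<^sub>t (n \<oplus>\<^bsub>N\<^esub> n')"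
      using s r ST X by (simp add: pure_add_right T.M.a_ac)
    then show ?case
      using s r T.submoduleE(5)[OF S] by blast
  qed
qed

end

locale tensor_pair_field = tensor_pair + field k
begin

text \<open>
  The nontrivial direction is by induction on a finite set spanning the first factors of \<open>t\<close>.  Write
  \<open>t = s + m \<otimes> n\<close> with the first factors of \<open>s\<close> in the span \<open>W\<close> of the other vectors.  If \<open>m \<notin> W\<close>,
  some functional vanishes on \<open>W\<close> and takes the value 1 at \<open>m\<close>.  It kills \<open>s\<close>, so that the
  slice of \<open>t\<close> along it is \<open>n\<close>.  Hence \<open>n \<in> V\<close>, and \<open>s\<close> inherits the hypothesis on slices.
\<close>

theorem mem_tensor_subspace_iff:
  assumes V: "submodule V k N"
  shows "t \<in> tensor_subspace k M N (carrier M) V \<longleftrightarrow>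
    t \<in> carrier T \<and> (\<forall>f\<in>functionals k M. slice k N f t \<in> V)"
proof (intro iffI conjI ballI)
  let ?MV = "tensor_subspace k M N (carrier M) V"
  note MV = tensor_subspace_submodule[OF M.carrier_is_submodule V]
  show "t \<in> carrier T" if "t \<in> ?MV"
    using that tensor_subspace_subset[OF M.carrier_is_submodule V] by blast
  show "slice k N f t \<in> V" if "t \<in> ?MV" "f \<in> functionals k M" for f
    using slice_subspace[OF V that(2,1)] .
  assume t: "t \<in> carrier T \<and> (\<forall>f\<in>functionals k M. slice k N f t \<in> V)"
  have "t \<in> ?MV"
    if "finite X" "X \<subseteq> carrier M" "t \<in> tensor_subspace k M N (module_span k M X) (carrier N)"
      "\<And>f. f \<in> functionals k M \<Longrightarrow> slice k N f t \<in> V" for X t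
    using that
  proof (induction X arbitrary: t rule: finite_induct)
    case empty
    have "module_span k M {} \<subseteq> {\<zero>\<^bsub>M\<^esub>}"
      by (rule M.module_span_least[OF M.zero_submodule]) simp
    then have "t = \<zero>\<^bsub>T\<^esub>"
      using empty(2) tensor_subspace_leI[OF M.submodule_module_span N.carrier_is_submodule T.zero_submodule, of "{}"]
        linear_maps_zero[OF M.module_axioms tensor_module pure_left] by blast
    then show ?case using T.submodule_zero[OF MV] by simp
  next
    case (insert m X)
    let ?W = "module_span k M X"
    let ?S = "tensor_subspace k M N ?W (carrier N)"
    have X: "X \<subseteq> carrier M" and m: "m \<in> carrier M" using insert.prems by auto
    note W = M.submodule_module_span[OF X]
    note S = tensor_subspace_submodule[OF W N.carrier_is_submodule]
    obtain s n where s: "s \<in> ?S" and n: "n \<in> carrier N" and t: "t = s \<oplus>\<^bsub>T\<^esub> m \<otimes>\<^sub>t n"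
      using tensor_subspace_insert[OF X m insert.prems(2)] by blast
    have sT: "s \<in> carrier T" using s T.submoduleE(1)[OF S] by blast
    show ?case
    proof (cases "m \<in> ?W")
      case True
      then have "t \<in> ?S"
        unfolding t using s n by (intro T.submoduleE(5)[OF S] tensor_subspace_pure[OF W N.carrier_is_submodule])
      then show ?thesis
        using insert.IH X insert.prems(3) by blast
    next
      case False
      obtain f where f: "f \<in> functionals k M" "\<And>w. w \<in> ?W \<Longrightarrow> f w = \<zero>\<^bsub>k\<^esub>" "f m = \<one>\<^bsub>k\<^esub>"
        using M.functional_separating[OF field_axioms W m False] by blast
      have "?S \<subseteq> {t \<in> carrier T. slice k N f t \<in> {\<zero>\<^bsub>N\<^esub>}}"
        by (rule tensor_subspace_leI[OF W N.carrier_is_submodule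
              linear_maps_preimage[OF tensor_module N.module_axioms slice_linear[OF f(1)] N.zero_submodule]])
          (use M.submoduleE(1)[OF W] f in \<open>auto simp: slice_pure\<close>)
      then have "slice k N f t = n"
        using s sT m n f by (auto simp: t linear_maps_add[OF slice_linear[OF f(1)]] slice_pure)
      then have nV: "n \<in> V" using insert.prems(3)[OF f(1)] by simp
      have "slice k N g s \<in> V" if g: "g \<in> functionals k M" for g
      proof -
        let ?gs = "slice k N g s"
        have gm: "g m \<odot>\<^bsub>N\<^esub> n \<in> V"
          using N.submoduleE(4)[OF V _ nV] linear_maps_closed[OF g m] by simp
        have gsN: "?gs \<in> carrier N"
          using linear_maps_closed[OF slice_linear[OF g] sT] .
        have "slice k N g t = ?gs \<oplus>\<^bsub>N\<^esub> g m \<odot>\<^bsub>N\<^esub> n"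
          using sT m n by (simp add: t linear_maps_add[OF slice_linear[OF g]] slice_pure[OF g])
        then have "(?gs \<oplus>\<^bsub>N\<^esub> g m \<odot>\<^bsub>N\<^esub> n) \<oplus>\<^bsub>N\<^esub> \<ominus>\<^bsub>N\<^esub> (g m \<odot>\<^bsub>N\<^esub> n) \<in> V"
          using insert.prems(3)[OF g] N.submoduleE(3)[OF V gm] N.submoduleE(5)[OF V] by metis
        moreover have "(?gs \<oplus>\<^bsub>N\<^esub> g m \<odot>\<^bsub>N\<^esub> n) \<oplus>\<^bsub>N\<^esub> \<ominus>\<^bsub>N\<^esub> (g m \<odot>\<^bsub>N\<^esub> n) = ?gs"
          using gsN gm N.submoduleE(1)[OF V] by (simp add: N.M.a_assoc N.M.r_neg subset_iff)
        ultimately show ?thesis by simp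
      qed
      then have "s \<in> ?MV"
        using insert.IH[OF X s] by blast
      then show ?thesis
        unfolding t using m nV
        by (intro T.submoduleE(5)[OF MV] tensor_subspace_pure[OF M.carrier_is_submodule V])
    qed
  qed
  then show "t \<in> ?MV"
    using t tensor_finite_span[of t] by blast
qed

text \<open>
  The case \<open>V = 0\<close>, applied to the difference of two tensors.
\<close>

corollary tensor_eq_iff_slices:
  assumes "t \<in> carrier T" "u \<in> carrier T"
  shows "t = u \<longleftrightarrow> (\<forall>f\<in>functionals k M. slice k N f t = slice k N f u)"
proof (intro iffI ballI)
  assume eq: "\<forall>f\<in>functionals k M. slice k N f t = slice k N f u"
  have "slice k N f (t \<ominus>\<^bsub>T\<^esub> u) \<in> {\<zero>\<^bsub>N\<^esub>}" if f: "f \<in> functionals k M" for f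
    using eq f assms linear_maps_closed[OF slice_linear[OF f]]
    by (simp add: linear_maps_minus[OF tensor_module N.module_axioms slice_linear[OF f]] N.minus_eq_zero_iff)
  then have "t \<ominus>\<^bsub>T\<^esub> u \<in> tensor_subspace k M N (carrier M) {\<zero>\<^bsub>N\<^esub>}"
    using mem_tensor_subspace_iff[OF N.zero_submodule, of "t \<ominus>\<^bsub>T\<^esub> u"] assms by (simp add: T.M.minus_closed)
  moreover have "tensor_subspace k M N (carrier M) {\<zero>\<^bsub>N\<^esub>} \<subseteq> {\<zero>\<^bsub>T\<^esub>}"
    by (rule tensor_subspace_leI[OF M.carrier_is_submodule N.zero_submodule T.zero_submodule])
      (use linear_maps_zero[OF N.module_axioms tensor_module pure_right] in simp)
  ultimately have "t \<ominus>\<^bsub>T\<^esub> u = \<zero>\<^bsub>T\<^esub>" by blast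
  then show "t = u" using T.minus_eq_zero_iff[OF assms] by blast
qed simp

end

section \<open>The tensor product of two algebras\<close>

context assoc_algebra begin

lemma left_mult_linear: "a \<in> carrier A \<Longrightarrow> (\<lambda>x. a \<otimes>\<^bsub>A\<^esub> x) \<in> linear_maps k A A"
  by (rule linear_mapsI) (auto simp: r_distr smult_mult_right)

lemma right_mult_linear: "a \<in> carrier A \<Longrightarrow> (\<lambda>x. x \<otimes>\<^bsub>A\<^esub> a) \<in> linear_maps k A A"
  by (rule linear_mapsI) (auto simp: l_distr smult_mult_left)

end

locale algebra_pair = K: field k + M: assoc_algebra k M + N: assoc_algebra k N
  for k :: "('k, 'r) ring_scheme" and M :: "('k, 'a, 'm) module_scheme"
    and N :: "('k, 'b, 'n) module_scheme"
begin

sublocale tensor_pair_field k M N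
  by (intro tensor_pair_field.intro tensor_pair.intro M.module_axioms N.module_axioms K.field_axioms)

abbreviation TA where "TA \<equiv> tensor_algebra k M N"

lemma tensor_algebra_simps:
  "carrier TA = carrier T" "add TA = add T" "smult TA = smult T" "zero TA = zero T"
  "one TA = \<one>\<^bsub>M\<^esub> \<otimes>\<^sub>t \<one>\<^bsub>N\<^esub>"
  "mult TA = (\<lambda>t u. tensor_lift k T (\<lambda>m n. tensor_lift k T
      (\<lambda>m' n'. (m \<otimes>\<^bsub>M\<^esub> m') \<otimes>\<^sub>t (n \<otimes>\<^bsub>N\<^esub> n')) u) t)"
  by (simp_all add: tensor_algebra_def Let_def)

lemma mult_pure_bilinear:
  assumes "m \<in> carrier M" "n \<in> carrier N"
  shows "(\<lambda>m' n'. (m \<otimes>\<^bsub>M\<^esub> m') \<otimes>\<^sub>t (n \<otimes>\<^bsub>N\<^esub> n')) \<in> bilinear_maps k M N T"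
  by (intro bilinear_mapsI linear_maps_compose[OF M.left_mult_linear pure_left]
      linear_maps_compose[OF N.left_mult_linear pure_right] assms) (use assms in auto)

lemma pure_mult_bilinear:
  assumes "u \<in> carrier T"
  shows "(\<lambda>m n. tensor_lift k T (\<lambda>m' n'. (m \<otimes>\<^bsub>M\<^esub> m') \<otimes>\<^sub>t (n \<otimes>\<^bsub>N\<^esub> n')) u) \<in> bilinear_maps k M N T"
proof (rule bilinear_mapsI)
  fix n assume n: "n \<in> carrier N"
  show "(\<lambda>m. tensor_lift k T (\<lambda>m' n'. (m \<otimes>\<^bsub>M\<^esub> m') \<otimes>\<^sub>t (n \<otimes>\<^bsub>N\<^esub> n')) u) \<in> linear_maps k M T"
    by (rule bilinear_maps_right[OF tensor_lift_bilinear[OF M.module_axioms tensor_module] assms])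
      (auto intro!: mult_pure_bilinear n linear_maps_compose[OF M.right_mult_linear pure_left])
next
  fix m assume m: "m \<in> carrier M"
  show "(\<lambda>n. tensor_lift k T (\<lambda>m' n'. (m \<otimes>\<^bsub>M\<^esub> m') \<otimes>\<^sub>t (n \<otimes>\<^bsub>N\<^esub> n')) u) \<in> linear_maps k N T"
    by (rule bilinear_maps_right[OF tensor_lift_bilinear[OF N.module_axioms tensor_module] assms])
      (auto intro!: mult_pure_bilinear m linear_maps_compose[OF N.right_mult_linear pure_right])
qed

lemma tensor_mult_bilinear: "mult TA \<in> bilinear_maps k T T T"
  unfolding tensor_algebra_simps
  by (rule tensor_lift_bilinear[OF tensor_module tensor_module])
    (auto intro!: pure_mult_bilinear tensor_lift_linear[OF tensor_module mult_pure_bilinear])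

lemma tensor_mult_pure:
  "\<lbrakk>m \<in> carrier M; n \<in> carrier N; m' \<in> carrier M; n' \<in> carrier N\<rbrakk> \<Longrightarrow>
    (m \<otimes>\<^sub>t n) \<otimes>\<^bsub>TA\<^esub> (m' \<otimes>\<^sub>t n') = (m \<otimes>\<^bsub>M\<^esub> m') \<otimes>\<^sub>t (n \<otimes>\<^bsub>N\<^esub> n')"
  by (simp add: tensor_algebra_simps tensor_lift_pure[OF tensor_module pure_mult_bilinear]
      tensor_lift_pure[OF tensor_module mult_pure_bilinear])

lemmas tensor_mult_left = bilinear_maps_left[OF tensor_mult_bilinear]
lemmas tensor_mult_right = bilinear_maps_right[OF tensor_mult_bilinear]

text \<open>
  Slices do not respect products, but multiplication by a pure tensor can be moved into the
  functional.
\<close>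

lemma slice_mult_pure_right:
  assumes f: "f \<in> functionals k M" and t: "t \<in> carrier T" and m: "m \<in> carrier M" and n: "n \<in> carrier N"
  shows "slice k N f (t \<otimes>\<^bsub>TA\<^esub> (m \<otimes>\<^sub>t n)) = slice k N (\<lambda>x. f (x \<otimes>\<^bsub>M\<^esub> m)) t \<otimes>\<^bsub>N\<^esub> n"
proof (rule tensor_ext[OF _ _ _ t])
  note fm = linear_maps_compose[OF M.right_mult_linear[OF m] f]
  show "(\<lambda>t. slice k N f (t \<otimes>\<^bsub>TA\<^esub> (m \<otimes>\<^sub>t n))) \<in> linear_maps k T N"
    using m n by (intro linear_maps_compose[OF tensor_mult_left slice_linear] f) auto
  show "(\<lambda>t. slice k N (\<lambda>x. f (x \<otimes>\<^bsub>M\<^esub> m)) t \<otimes>\<^bsub>N\<^esub> n) \<in> linear_maps k T N"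
    by (rule linear_maps_compose[OF slice_linear[OF fm] N.right_mult_linear[OF n]])
  fix m' n' assume "m' \<in> carrier M" "n' \<in> carrier N"
  then show "slice k N f ((m' \<otimes>\<^sub>t n') \<otimes>\<^bsub>TA\<^esub> (m \<otimes>\<^sub>t n)) =
      slice k N (\<lambda>x. f (x \<otimes>\<^bsub>M\<^esub> m)) (m' \<otimes>\<^sub>t n') \<otimes>\<^bsub>N\<^esub> n"
    using m n linear_maps_closed[OF f, of "m' \<otimes>\<^bsub>M\<^esub> m"]
    by (simp add: tensor_mult_pure slice_pure f fm N.smult_mult_left)
qed

lemma slice_mult_pure_left:
  assumes f: "f \<in> functionals k M" and t: "t \<in> carrier T" and m: "m \<in> carrier M"
  shows "slice k N f ((m \<otimes>\<^sub>t \<one>\<^bsub>N\<^esub>) \<otimes>\<^bsub>TA\<^esub> t) = slice k N (\<lambda>x. f (m \<otimes>\<^bsub>M\<^esub> x)) t"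
proof (rule tensor_ext[OF _ _ _ t])
  note fm = linear_maps_compose[OF M.left_mult_linear[OF m] f]
  show "(\<lambda>t. slice k N f ((m \<otimes>\<^sub>t \<one>\<^bsub>N\<^esub>) \<otimes>\<^bsub>TA\<^esub> t)) \<in> linear_maps k T N"
    using m by (intro linear_maps_compose[OF tensor_mult_right slice_linear] f) auto
  show "slice k N (\<lambda>x. f (m \<otimes>\<^bsub>M\<^esub> x)) \<in> linear_maps k T N"
    by (rule slice_linear[OF fm])
  fix m' n' assume "m' \<in> carrier M" "n' \<in> carrier N"
  then show "slice k N f ((m \<otimes>\<^sub>t \<one>\<^bsub>N\<^esub>) \<otimes>\<^bsub>TA\<^esub> (m' \<otimes>\<^sub>t n')) = slice k N (\<lambda>x. f (m \<otimes>\<^bsub>M\<^esub> x)) (m' \<otimes>\<^sub>t n')"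
    using m by (simp add: tensor_mult_pure slice_pure f fm)
qed

end


lemma is_subalgebraI:
  assumes "assoc_algebra k A" "submodule S k A" "\<one>\<^bsub>A\<^esub> \<in> S"
    "\<And>a b. \<lbrakk>a \<in> S; b \<in> S\<rbrakk> \<Longrightarrow> a \<otimes>\<^bsub>A\<^esub> b \<in> S"
  shows "is_subalgebra k A S"
proof -
  interpret A: assoc_algebra k A by fact
  show ?thesis
    unfolding is_subalgebra_def
    using assms(2-4) A.submoduleE[OF assms(2)] by (auto intro!: A.subringI)
qed

section \<open>Coefficients of the coaction\<close>

context bialgebra begin

lemma counit_functional: "\<epsilon> \<in> functionals k H"
  using counit_ring_hom counit_smult
  by (intro linear_mapsI) (auto simp: ring_hom_def Pi_iff)

lemma counit_closed: "h \<in> carrier H \<Longrightarrow> \<epsilon> h \<in> carrier k"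
  using linear_maps_closed[OF counit_functional] by simp

lemma counit_one: "\<epsilon> \<one>\<^bsub>H\<^esub> = \<one>\<^bsub>k\<^esub>"
  and counit_mult: "\<lbrakk>x \<in> carrier H; y \<in> carrier H\<rbrakk> \<Longrightarrow> \<epsilon> (x \<otimes>\<^bsub>H\<^esub> y) = \<epsilon> x \<otimes>\<^bsub>k\<^esub> \<epsilon> y"
  using counit_ring_hom by (auto simp: ring_hom_def)

end

text \<open>
  Every statement about comodule algebras therefore also holds for \<open>H\<close> coacting on itself by \<open>\<Delta>\<close>.
\<close>

lemma (in hopf_algebra) regular_comodule: "comodule_algebra k H \<Delta> \<epsilon> H \<Delta>"
  by (intro comodule_algebra.intro comodule_algebra_axioms.intro hopf_algebra_axioms
      H.assoc_algebra_axioms comult_linear comult_ring_hom coassoc counit_right)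

context comodule_algebra begin

sublocale AH: algebra_pair k A H
  by (intro algebra_pair.intro H.K.field_axioms A.assoc_algebra_axioms H.H.assoc_algebra_axioms)

sublocale HH: algebra_pair k H H
  by (intro algebra_pair.intro H.K.field_axioms H.H.assoc_algebra_axioms)

abbreviation coeff where "coeff f a \<equiv> slice k H f (\<delta> a)"

lemma coact_closed: "a \<in> carrier A \<Longrightarrow> \<delta> a \<in> carrier AH.T"
  by (rule linear_maps_closed[OF coact_linear])

lemma coact_mult: "\<lbrakk>a \<in> carrier A; b \<in> carrier A\<rbrakk> \<Longrightarrow> \<delta> (a \<otimes>\<^bsub>A\<^esub> b) = \<delta> a \<otimes>\<^bsub>AH.TA\<^esub> \<delta> b"
  and coact_one: "\<delta> \<one>\<^bsub>A\<^esub> = pure_tensor k A H \<one>\<^bsub>A\<^esub> \<one>\<^bsub>H\<^esub>"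
  using coact_ring_hom by (auto simp: ring_hom_def AH.tensor_algebra_simps(5))

lemma coeff_linear: "f \<in> functionals k A \<Longrightarrow> coeff f \<in> linear_maps k A H"
  by (rule linear_maps_compose[OF coact_linear AH.slice_linear])

lemma coeff_closed: "\<lbrakk>f \<in> functionals k A; a \<in> carrier A\<rbrakk> \<Longrightarrow> coeff f a \<in> carrier H"
  by (rule linear_maps_closed[OF coeff_linear])

lemma counit_right_bilinear: "(\<lambda>x h. \<epsilon> h \<odot>\<^bsub>A\<^esub> x) \<in> bilinear_maps k A H A"
proof (intro bilinear_mapsI linear_mapsI)
  show "\<epsilon> h \<odot>\<^bsub>A\<^esub> (c \<odot>\<^bsub>A\<^esub> x) = c \<odot>\<^bsub>A\<^esub> (\<epsilon> h \<odot>\<^bsub>A\<^esub> x)"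
    if "h \<in> carrier H" "c \<in> carrier k" "x \<in> carrier A" for h c x
    using that H.counit_closed[OF that(1)] by (metis A.smult_assoc1 H.K.m_comm)
qed (simp_all add: H.counit_closed linear_maps_add[OF H.counit_functional] H.counit_smult
    A.smult_l_distr A.smult_r_distr A.smult_assoc1)

lemma counit_coeff:
  assumes f: "f \<in> functionals k A" and a: "a \<in> carrier A"
  shows "\<epsilon> (coeff f a) = f a"
proof -
  have "\<epsilon> (slice k H f t) = f (tensor_lift k A (\<lambda>x h. \<epsilon> h \<odot>\<^bsub>A\<^esub> x) t)" if t: "t \<in> carrier AH.T" for t
  proof (rule AH.tensor_ext[OF linear_maps_compose[OF AH.slice_linear[OF f] H.counit_functional]
        linear_maps_compose[OF AH.tensor_lift_linear[OF A.module_axioms counit_right_bilinear] f] _ t])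
    fix x h assume xh: "x \<in> carrier A" "h \<in> carrier H"
    then show "\<epsilon> (slice k H f (pure_tensor k A H x h)) =
        f (tensor_lift k A (\<lambda>x h. \<epsilon> h \<odot>\<^bsub>A\<^esub> x) (pure_tensor k A H x h))"
      using linear_maps_closed[OF f xh(1)]
      by (simp add: AH.slice_pure f AH.tensor_lift_pure[OF A.module_axioms counit_right_bilinear] H.counit_smult
          H.counit_closed linear_maps_smult[OF f] H.K.m_comm)
  qed
  then show ?thesis
    using coact_closed[OF a] coact_counit[OF a] by simp
qed

text \<open>
  Both sides are \<open>f \<otimes> g \<otimes> id\<close> applied to the two sides of the coassociativity law.  For
  \<open>(id \<otimes> \<Delta>) (\<delta> a)\<close>, slicing along \<open>f\<close> commutes with \<open>\<Delta>\<close>; for \<open>(\<delta> \<otimes> id) (\<delta> a)\<close>, the functionals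
  \<open>f\<close> and \<open>g\<close> act on \<open>\<delta>\<close> of the first factor and combine into the single functional \<open>g \<circ> \<delta>\<^sub>f\<close>.
\<close>

lemma coeff_coassoc:
  assumes f: "f \<in> functionals k A" and g: "g \<in> functionals k H" and a: "a \<in> carrier A"
  shows "slice k H g (\<Delta> (coeff f a)) = coeff (\<lambda>x. g (coeff f x)) a"
proof -
  interpret AHH: tensor_pair k A HH.T
    by (intro tensor_pair.intro A.module_axioms HH.tensor_module)
  interpret AH_H: tensor_pair k AH.T H
    by (intro tensor_pair.intro H.H.module_axioms AH.tensor_module)
  note gf = linear_maps_compose[OF coeff_linear[OF f] g]
  have id: "id \<in> linear_maps k A A" "id \<in> linear_maps k H H"
    by (auto intro: linear_mapsI)
  have fc: "f x \<in> carrier k" if "x \<in> carrier A" for x using linear_maps_closed[OF f that] by simp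
  have gc: "g x \<in> carrier k" if "x \<in> carrier H" for x using linear_maps_closed[OF g that] by simp
  note slices = linear_maps_compose[OF AHH.slice_linear[OF f] HH.slice_linear[OF g]]
  note \<Delta>map = A.module_axioms HH.tensor_module id(1) H.comult_linear
  note \<delta>map = AH.tensor_module H.H.module_axioms coact_linear id(2)
  have right: "slice k HH.T f (tensor_map k A HH.T id \<Delta> t) = \<Delta> (slice k H f t)"
    if t: "t \<in> carrier AH.T" for t
    by (rule AH.tensor_ext[OF linear_maps_compose[OF AH.tensor_map_linear[OF \<Delta>map] AHH.slice_linear[OF f]]
          linear_maps_compose[OF AH.slice_linear[OF f] H.comult_linear] _ t])
      (simp add: AH.tensor_map_pure[OF \<Delta>map] AHH.slice_pure[OF f] AH.slice_pure[OF f] fc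
        linear_maps_smult[OF H.comult_linear] linear_maps_closed[OF H.comult_linear])
  let ?b = "\<lambda>p m n. pure_tensor k A HH.T m (pure_tensor k H H n p)"
  have b: "?b p \<in> bilinear_maps k A H AHH.T" if "p \<in> carrier H" for p
    using that
    by (intro bilinear_mapsI AHH.pure_left linear_maps_compose[OF HH.pure_left AHH.pure_right]) auto
  have B: "(\<lambda>t p. tensor_lift k AHH.T (?b p) t) \<in> bilinear_maps k AH.T H AHH.T"
    using b by (intro AH.tensor_lift_bilinear[OF H.H.module_axioms AHH.tensor_module]
        linear_maps_compose[OF HH.pure_right AHH.pure_right]) auto
  have assoc_def: "tensor_assoc k A H H = tensor_lift k AHH.T (\<lambda>t p. tensor_lift k AHH.T (?b p) t)"
    by (simp add: tensor_assoc_def Let_def)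
  have slice_b: "slice k H g (slice k HH.T f (tensor_lift k AHH.T (?b p) t)) = g (slice k H f t) \<odot>\<^bsub>H\<^esub> p"
    if t: "t \<in> carrier AH.T" and p: "p \<in> carrier H" for t p
  proof (rule AH.tensor_ext[OF linear_maps_compose[OF AH.tensor_lift_linear[OF AHH.tensor_module b[OF p]] slices] _ _ t])
    show "(\<lambda>t. g (slice k H f t) \<odot>\<^bsub>H\<^esub> p) \<in> linear_maps k AH.T H"
      by (rule linear_maps_compose[OF linear_maps_compose[OF AH.slice_linear[OF f] g]
            bilinear_maps_left[OF _ p]])
        (auto intro!: bilinear_mapsI linear_mapsI simp: H.H.smult_l_distr H.H.smult_r_distr H.H.smult_assoc1
          , metis H.H.smult_assoc1 H.K.m_comm)
    fix m n assume "m \<in> carrier A" "n \<in> carrier H"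
    then show "slice k H g (slice k HH.T f (tensor_lift k AHH.T (?b p) (pure_tensor k A H m n))) =
        g (slice k H f (pure_tensor k A H m n)) \<odot>\<^bsub>H\<^esub> p"
      using p
      by (simp add: AH.tensor_lift_pure[OF AHH.tensor_module b] AHH.slice_pure[OF f] AH.slice_pure[OF f]
          linear_maps_smult[OF HH.slice_linear[OF g]] HH.slice_pure[OF g] fc gc linear_maps_smult[OF g]
          H.H.smult_assoc1)
  qed
  have left: "slice k H g (slice k HH.T f (tensor_assoc k A H H (tensor_map k AH.T H \<delta> id t))) =
      slice k H (\<lambda>x. g (coeff f x)) t"
    if t: "t \<in> carrier AH.T" for t
    unfolding assoc_def
    by (rule AH.tensor_ext[OF linear_maps_compose[OF AH.tensor_map_linear[OF \<delta>map]
            linear_maps_compose[OF AH_H.tensor_lift_linear[OF AHH.tensor_module B] slices]]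
          AH.slice_linear[OF gf] _ t])
      (simp add: AH.tensor_map_pure[OF \<delta>map] AH_H.tensor_lift_pure[OF AHH.tensor_module B]
        coact_closed slice_b AH.slice_pure[OF gf])
  have "slice k H g (\<Delta> (coeff f a)) = slice k H g (slice k HH.T f (tensor_map k A HH.T id \<Delta> (\<delta> a)))"
    using right[OF coact_closed[OF a]] by simp
  also have "\<dots> = coeff (\<lambda>x. g (coeff f x)) a"
    using left[OF coact_closed[OF a]] coact_coassoc[OF a] by simp
  finally show ?thesis .
qed

lemma coeff_one: "f \<in> functionals k A \<Longrightarrow> coeff f \<one>\<^bsub>A\<^esub> = f \<one>\<^bsub>A\<^esub> \<odot>\<^bsub>H\<^esub> \<one>\<^bsub>H\<^esub>"
  by (simp add: coact_one AH.slice_pure)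


section \<open>Coinvariants of quotients\<close>

text \<open>
  The slices of \<open>(id \<otimes> \<pi>) (\<delta> a)\<close> and of \<open>a \<otimes> \<pi> 1\<close> in \<open>A \<otimes> H/I\<close> along \<open>f\<close> are the cosets of
  \<open>\<delta>\<^sub>f a\<close> and of \<open>f(a) 1\<close>, and slices determine a tensor.
\<close>

lemma quotient_coinvariants_iff:
  assumes I: "submodule I k H"
  shows "a \<in> quotient_coinvariants k H A \<delta> (quotient_module H I) \<longleftrightarrow>
    a \<in> carrier A \<and> (\<forall>f\<in>functionals k A. coeff f a \<ominus>\<^bsub>H\<^esub> f a \<odot>\<^bsub>H\<^esub> \<one>\<^bsub>H\<^esub> \<in> I)"
proof (cases "a \<in> carrier A")
  case a: True
  interpret Q: quotient_by k H I
    by (intro quotient_by.intro quotient_by_axioms.intro H.H.module_axioms I)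
  let ?Q = "quotient_module H I"
  interpret AQ: tensor_pair_field k A ?Q
    by (intro tensor_pair_field.intro tensor_pair.intro A.module_axioms Q.quotient_module H.K.field_axioms)
  have \<pi>: "quotient_proj H ?Q = Q.coset"
    by (auto simp: quotient_proj_def)
  have id: "id \<in> linear_maps k A A"
    by (auto intro: linear_mapsI)
  note m = A.module_axioms Q.quotient_module id Q.coset_linear
  have slice_map: "slice k ?Q f (tensor_map k A ?Q id Q.coset t) = Q.coset (slice k H f t)"
    if f: "f \<in> functionals k A" and t: "t \<in> carrier AH.T" for f t
    by (rule AH.tensor_ext[OF linear_maps_compose[OF AH.tensor_map_linear[OF m] AQ.slice_linear[OF f]]
          linear_maps_compose[OF AH.slice_linear[OF f] Q.coset_linear] _ t])
      (use linear_maps_closed[OF f] in \<open>simp add: AH.tensor_map_pure[OF m] AQ.slice_pure[OF f] AH.slice_pure[OF f]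
        Q.coset_smult\<close>)
  have "a \<in> quotient_coinvariants k H A \<delta> ?Q \<longleftrightarrow>
      tensor_map k A ?Q id Q.coset (\<delta> a) = pure_tensor k A ?Q a (Q.coset \<one>\<^bsub>H\<^esub>)"
    using a by (simp add: quotient_coinvariants_def \<pi>)
  also have "\<dots> \<longleftrightarrow> (\<forall>f\<in>functionals k A. slice k ?Q f (tensor_map k A ?Q id Q.coset (\<delta> a)) =
      slice k ?Q f (pure_tensor k A ?Q a (Q.coset \<one>\<^bsub>H\<^esub>)))"
    using a by (intro AQ.tensor_eq_iff_slices linear_maps_closed[OF AH.tensor_map_linear[OF m]] coact_closed
        AQ.pure_closed) auto
  also have "\<dots> \<longleftrightarrow> (\<forall>f\<in>functionals k A. Q.coset (coeff f a) = Q.coset (f a \<odot>\<^bsub>H\<^esub> \<one>\<^bsub>H\<^esub>))"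
    using a linear_maps_closed[of _ k A "regular_module k" a]
    by (intro ball_cong) (simp_all add: slice_map coact_closed AQ.slice_pure Q.coset_smult)
  also have "\<dots> \<longleftrightarrow> (\<forall>f\<in>functionals k A. coeff f a \<ominus>\<^bsub>H\<^esub> f a \<odot>\<^bsub>H\<^esub> \<one>\<^bsub>H\<^esub> \<in> I)"
    using a linear_maps_closed[of _ k A "regular_module k" a]
    by (intro ball_cong) (simp_all add: Q.coset_eq_iff coeff_closed)
  finally show ?thesis using a by simp
qed (simp add: quotient_coinvariants_def)

end

context comodule_algebra begin

text \<open>
  Closure under products, modulo \<open>I\<close> and after slicing along \<open>f\<close>: in \<open>\<delta>(a b) = \<delta> a \<cdot> \<delta> b\<close> the left
  factor may be replaced by \<open>a \<otimes> 1\<close>, because the error lies in \<open>I\<close> and stays there under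
  multiplication from the right; then \<open>(a \<otimes> 1) \<cdot> \<delta> b\<close> is sliced by applying \<open>f(a \<cdot> _)\<close> to \<open>\<delta> b\<close>.
\<close>

lemma quotient_coinvariants_subalgebra:
  assumes I: "submodule I k H" and right: "right_ideal I H"
  shows "is_subalgebra k A (quotient_coinvariants k H A \<delta> (quotient_module H I))" (is "is_subalgebra k A ?C")
proof (rule is_subalgebraI[OF A.assoc_algebra_axioms])
  note C = quotient_coinvariants_iff[OF I]
  have fc: "f a \<in> carrier k" if "f \<in> functionals k A" "a \<in> carrier A" for f a
    using linear_maps_closed[OF that] by simp
  have d: "(\<lambda>a. coeff f a \<ominus>\<^bsub>H\<^esub> f a \<odot>\<^bsub>H\<^esub> \<one>\<^bsub>H\<^esub>) \<in> linear_maps k A H" if f: "f \<in> functionals k A" for f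
    by (intro linear_maps_difference H.H.module_axioms coeff_linear f linear_mapsI)
      (simp_all add: fc f linear_maps_add[OF f] linear_maps_smult[OF f] H.H.smult_l_distr H.H.smult_assoc1)
  have eq: "?C = \<Inter>(insert (carrier A) ((\<lambda>f. {a \<in> carrier A. coeff f a \<ominus>\<^bsub>H\<^esub> f a \<odot>\<^bsub>H\<^esub> \<one>\<^bsub>H\<^esub> \<in> I}) ` functionals k A))"
    using C by auto
  show "submodule ?C k A"
    unfolding eq
    by (rule A.submodule_Inter)
      (auto intro: A.carrier_is_submodule linear_maps_preimage[OF A.module_axioms H.H.module_axioms d I])
  show "\<one>\<^bsub>A\<^esub> \<in> ?C"
    using H.H.submodule_zero[OF I] by (simp add: C coeff_one fc a_minus_def H.H.r_neg)
  fix a b assume "a \<in> ?C" "b \<in> ?C"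
  then have a: "a \<in> carrier A" "\<And>f. f \<in> functionals k A \<Longrightarrow> coeff f a \<ominus>\<^bsub>H\<^esub> f a \<odot>\<^bsub>H\<^esub> \<one>\<^bsub>H\<^esub> \<in> I"
    and b: "b \<in> carrier A" "\<And>f. f \<in> functionals k A \<Longrightarrow> coeff f b \<ominus>\<^bsub>H\<^esub> f b \<odot>\<^bsub>H\<^esub> \<one>\<^bsub>H\<^esub> \<in> I"
    by (auto simp: C)
  show "a \<otimes>\<^bsub>A\<^esub> b \<in> ?C"
    unfolding C
  proof (intro conjI ballI)
    show "a \<otimes>\<^bsub>A\<^esub> b \<in> carrier A" using a b by simp
    fix f assume f: "f \<in> functionals k A"
    let ?a1 = "pure_tensor k A H a \<one>\<^bsub>H\<^esub>"
    let ?D = "\<lambda>u. slice k H f (\<delta> a \<otimes>\<^bsub>AH.TA\<^esub> u) \<ominus>\<^bsub>H\<^esub> slice k H f (?a1 \<otimes>\<^bsub>AH.TA\<^esub> u)"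
    have a1: "?a1 \<in> carrier AH.T" using a by simp
    note fa = linear_maps_compose[OF A.left_mult_linear[OF a(1)] f]
    have D: "?D \<in> linear_maps k AH.T H"
      by (intro linear_maps_difference H.H.module_axioms
          linear_maps_compose[OF AH.tensor_mult_right AH.slice_linear[OF f]] coact_closed a a1)
    \<comment> \<open>Replacing the left factor \<open>\<delta> a\<close> by \<open>a \<otimes> 1\<close> changes slices of products by elements of \<open>I\<close> only.\<close>
    have DI: "?D u \<in> I" if "u \<in> carrier AH.T" for u
      using that
    proof (induction rule: AH.tensor_induct)
      case (pure x h)
      note fx = linear_maps_compose[OF A.right_mult_linear[OF pure(1)] f]
      let ?g = "\<lambda>y. f (y \<otimes>\<^bsub>A\<^esub> x)"
      have "?D (pure_tensor k A H x h) = coeff ?g a \<otimes>\<^bsub>H\<^esub> h \<ominus>\<^bsub>H\<^esub> (?g a \<odot>\<^bsub>H\<^esub> \<one>\<^bsub>H\<^esub>) \<otimes>\<^bsub>H\<^esub> h"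
        using pure a by (simp add: AH.slice_mult_pure_right f coact_closed AH.slice_pure[OF fx])
      also have "\<dots> = (coeff ?g a \<ominus>\<^bsub>H\<^esub> ?g a \<odot>\<^bsub>H\<^esub> \<one>\<^bsub>H\<^esub>) \<otimes>\<^bsub>H\<^esub> h"
        using pure a coeff_closed[OF fx a(1)] fc[OF f]
        by (simp add: a_minus_def H.H.l_distr H.H.l_minus)
      finally show ?case
        using right a(2)[OF fx] pure(2) unfolding right_ideal_def by simp
    next
      case (add t u)
      then show ?case
        using H.H.submoduleE(5)[OF I] by (simp add: linear_maps_add[OF D])
    qed
    have 1: "coeff f (a \<otimes>\<^bsub>A\<^esub> b) \<ominus>\<^bsub>H\<^esub> coeff (\<lambda>x. f (a \<otimes>\<^bsub>A\<^esub> x)) b \<in> I"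
      using DI[OF coact_closed[OF b(1)]] a(1) b(1)
      by (simp add: coact_mult AH.slice_mult_pure_left[OF f] coact_closed)
    have 2: "coeff (\<lambda>x. f (a \<otimes>\<^bsub>A\<^esub> x)) b \<ominus>\<^bsub>H\<^esub> f (a \<otimes>\<^bsub>A\<^esub> b) \<odot>\<^bsub>H\<^esub> \<one>\<^bsub>H\<^esub> \<in> I"
      using b(2)[OF fa] .
    have "(x \<ominus>\<^bsub>H\<^esub> y) \<oplus>\<^bsub>H\<^esub> (y \<ominus>\<^bsub>H\<^esub> z) = x \<ominus>\<^bsub>H\<^esub> z"
      if "x \<in> carrier H" "y \<in> carrier H" "z \<in> carrier H" for x y z
      using that by (simp add: a_minus_def H.H.M.a_assoc H.H.r_neg2 H.H.r_neg1)
    then show "coeff f (a \<otimes>\<^bsub>A\<^esub> b) \<ominus>\<^bsub>H\<^esub> f (a \<otimes>\<^bsub>A\<^esub> b) \<odot>\<^bsub>H\<^esub> \<one>\<^bsub>H\<^esub> \<in> I"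
      using H.H.submoduleE(5)[OF I 1 2] a b coeff_closed[OF f] coeff_closed[OF fa] fc[OF f] by simp
  qed
qed

text \<open>
  The condition on \<open>\<delta>\<^sub>f a\<close> for a functional \<open>g\<close> on \<open>H\<close> is, by coassociativity, the condition on
  \<open>a\<close> for the functional \<open>g \<circ> \<delta>\<^sub>f\<close>.
\<close>

lemma coact_quotient_coinvariants:
  assumes I: "submodule I k H"
    and a: "a \<in> quotient_coinvariants k H A \<delta> (quotient_module H I)"
    and sub: "submodule (quotient_coinvariants k H H \<Delta> (quotient_module H I)) k H"
  shows "\<delta> a \<in> tensor_subspace k A H (carrier A) (quotient_coinvariants k H H \<Delta> (quotient_module H I))"
proof -
  interpret R: comodule_algebra k H \<Delta> \<epsilon> H \<Delta> by (rule H.regular_comodule)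
  have aA: "a \<in> carrier A" and aI: "\<And>f. f \<in> functionals k A \<Longrightarrow> coeff f a \<ominus>\<^bsub>H\<^esub> f a \<odot>\<^bsub>H\<^esub> \<one>\<^bsub>H\<^esub> \<in> I"
    using a unfolding quotient_coinvariants_iff[OF I] by auto
  show ?thesis
    unfolding AH.mem_tensor_subspace_iff[OF sub] R.quotient_coinvariants_iff[OF I]
  proof (intro conjI ballI)
    show "\<delta> a \<in> carrier AH.T" using coact_closed[OF aA] .
    fix f assume f: "f \<in> functionals k A"
    show "coeff f a \<in> carrier H" using coeff_closed[OF f aA] .
    fix g assume g: "g \<in> functionals k H"
    show "slice k H g (\<Delta> (coeff f a)) \<ominus>\<^bsub>H\<^esub> g (coeff f a) \<odot>\<^bsub>H\<^esub> \<one>\<^bsub>H\<^esub> \<in> I"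
      unfolding coeff_coassoc[OF f g aA]
      using aI[OF linear_maps_compose[OF coeff_linear[OF f] g]] .
  qed
qed

end


section \<open>Left coideal subalgebras and right ideal coideals\<close>

lemma Sub_gen_iff:
  "K \<in> carrier (Sub_gen k H \<Delta>) \<longleftrightarrow>
    is_subalgebra k H K \<and> \<Delta> ` K \<subseteq> tensor_subspace k H H (carrier H) K"
  by (simp add: Sub_gen_def)

context hopf_algebra begin

interpretation R: comodule_algebra k H \<Delta> \<epsilon> H \<Delta> by (rule regular_comodule)

lemma coinvariants_left_coideal_subalgebra:
  assumes I: "submodule I k H" "right_ideal I H"
  shows "quotient_coinvariants k H H \<Delta> (quotient_module H I) \<in> carrier (Sub_gen k H \<Delta>)"
  using R.quotient_coinvariants_subalgebra[OF I] R.coact_quotient_coinvariants[OF I(1)]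
  unfolding Sub_gen_iff is_subalgebra_def by blast

text \<open>
  The defining condition of a coinvariant \<open>h\<close> for the functional \<open>\<epsilon>\<close> reads \<open>h - \<epsilon>(h) 1 \<in> I\<close>.
\<close>

lemma augmentation_coinvariants:
  assumes I: "submodule I k H"
  shows "augmentation_part k \<epsilon> (quotient_coinvariants k H H \<Delta> (quotient_module H I)) \<subseteq> I"
proof
  fix h assume "h \<in> augmentation_part k \<epsilon> (quotient_coinvariants k H H \<Delta> (quotient_module H I))"
  then have h: "h \<in> carrier H" "\<epsilon> h = \<zero>\<^bsub>k\<^esub>"
    and hI: "slice k H \<epsilon> (\<Delta> h) \<ominus>\<^bsub>H\<^esub> \<epsilon> h \<odot>\<^bsub>H\<^esub> \<one>\<^bsub>H\<^esub> \<in> I"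
    unfolding augmentation_part_def R.quotient_coinvariants_iff[OF I] using counit_functional by auto
  have "slice k H \<epsilon> (\<Delta> h) = h"
    using counit_left[OF h(1)] by (simp add: slice_def)
  then show "h \<in> I"
    using hI h by (simp add: a_minus_def)
qed

lemma augmentation_ideal_submodule:
  assumes "submodule K k H"
  shows "submodule (product_span k H (augmentation_part k \<epsilon> K) (carrier H)) k H"
  unfolding product_span_def
  by (rule H.submodule_module_span)
    (use H.submoduleE(1)[OF assms] in \<open>auto simp: augmentation_part_def\<close>)

lemma product_span_least:
  assumes "submodule X k H" "\<And>u h. \<lbrakk>u \<in> U; h \<in> V\<rbrakk> \<Longrightarrow> u \<otimes>\<^bsub>H\<^esub> h \<in> X"
  shows "product_span k H U V \<subseteq> X"
  unfolding product_span_def using assms by (intro H.module_span_least) auto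

lemma product_span_mem: "\<lbrakk>u \<in> U; v \<in> V\<rbrakk> \<Longrightarrow> u \<otimes>\<^bsub>H\<^esub> v \<in> product_span k H U V"
  unfolding product_span_def by (rule subsetD[OF H.module_span_superset]) blast

lemma augmentation_ideal_right_ideal:
  assumes K: "submodule K k H"
  shows "right_ideal (product_span k H (augmentation_part k \<epsilon> K) (carrier H)) H" (is "right_ideal ?J H")
  unfolding right_ideal_def
proof (intro conjI ballI)
  note J = augmentation_ideal_submodule[OF K]
  show "additive_subgroup ?J H"
    using submodule.axioms(1)[OF J] by (rule additive_subgroupI)
  fix x h assume x: "x \<in> ?J" and h: "h \<in> carrier H"
  have "?J \<subseteq> {x \<in> carrier H. x \<otimes>\<^bsub>H\<^esub> h \<in> ?J}"
  proof (rule product_span_least[OF linear_maps_preimage[OF H.module_axioms H.module_axioms H.right_mult_linear[OF h] J]])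
    fix u v assume u: "u \<in> augmentation_part k \<epsilon> K" and v: "v \<in> carrier H"
    have uH: "u \<in> carrier H"
      using u H.submoduleE(1)[OF K] by (auto simp: augmentation_part_def)
    show "u \<otimes>\<^bsub>H\<^esub> v \<in> {x \<in> carrier H. x \<otimes>\<^bsub>H\<^esub> h \<in> ?J}"
      using uH v h product_span_mem[OF u, of "v \<otimes>\<^bsub>H\<^esub> h"] by (simp add: H.m_assoc)
  qed
  then show "x \<otimes>\<^bsub>H\<^esub> h \<in> ?J" using x by blast
qed

text \<open>
  Since \<open>\<epsilon> 1 = 1\<close>, every \<open>x \<in> K\<close> agrees with the scalar \<open>\<epsilon>(x) 1\<close> modulo \<open>K\<^sup>+\<close>, and so \<open>x h\<close> agrees
  with \<open>\<epsilon>(x) h\<close> modulo \<open>K\<^sup>+ H\<close>.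
\<close>

lemma minus_counit_mem:
  assumes K: "is_subalgebra k H K" and x: "x \<in> K"
  shows "x \<ominus>\<^bsub>H\<^esub> \<epsilon> x \<odot>\<^bsub>H\<^esub> \<one>\<^bsub>H\<^esub> \<in> augmentation_part k \<epsilon> K"
proof -
  have sub: "submodule K k H" and one: "\<one>\<^bsub>H\<^esub> \<in> K"
    using K subringE(3) unfolding is_subalgebra_def by auto
  have xH: "x \<in> carrier H" using x H.submoduleE(1)[OF sub] by blast
  have "\<epsilon> (x \<ominus>\<^bsub>H\<^esub> \<epsilon> x \<odot>\<^bsub>H\<^esub> \<one>\<^bsub>H\<^esub>) = \<epsilon> x \<ominus>\<^bsub>regular_module k\<^esub> (\<epsilon> x \<otimes>\<^bsub>k\<^esub> \<epsilon> \<one>\<^bsub>H\<^esub>)"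
    using xH counit_closed[OF xH]
    by (simp add: linear_maps_minus[OF H.module_axioms K.regular_module counit_functional] counit_smult)
  also have "\<dots> = \<zero>\<^bsub>k\<^esub>"
    using counit_closed[OF xH] module.minus_eq_zero_iff[OF K.regular_module, of "\<epsilon> x" "\<epsilon> x"] by (simp add: counit_one)
  finally show ?thesis
    using x one counit_closed[OF xH] H.submodule_minus[OF sub] H.submoduleE(4)[OF sub]
    by (simp add: augmentation_part_def)
qed

lemma minus_counit_mult_mem:
  assumes "is_subalgebra k H K" "x \<in> K" "h \<in> carrier H"
  shows "(x \<ominus>\<^bsub>H\<^esub> \<epsilon> x \<odot>\<^bsub>H\<^esub> \<one>\<^bsub>H\<^esub>) \<otimes>\<^bsub>H\<^esub> h \<in> product_span k H (augmentation_part k \<epsilon> K) (carrier H)"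
  by (rule product_span_mem[OF minus_counit_mem[OF assms(1,2)] assms(3)])

text \<open>
  Write \<open>J\<close> for \<open>K\<^sup>+ H\<close>.  For \<open>u \<in> K\<^sup>+\<close> the second factors of \<open>\<Delta> u\<close> lie in \<open>K\<close>.  Replacing such a
  factor \<open>y\<close> by \<open>\<epsilon>(y) 1\<close> turns \<open>\<Delta> u\<close> into \<open>u \<otimes> 1\<close> and changes \<open>\<Delta> u \<cdot> \<Delta> h\<close> by an element of
  \<open>H \<otimes> J\<close>, while \<open>(u \<otimes> 1) \<cdot> \<Delta> h\<close> lies in \<open>J \<otimes> H\<close>.
\<close>

lemma augmentation_ideal_coideal:
  assumes K: "K \<in> carrier (Sub_gen k H \<Delta>)"
  shows "coideal k H \<Delta> \<epsilon> (product_span k H (augmentation_part k \<epsilon> K) (carrier H))" (is "coideal k H \<Delta> \<epsilon> ?J")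
  unfolding coideal_def
proof (intro conjI)
  have alg: "is_subalgebra k H K" and sub: "submodule K k H"
    and \<Delta>K: "\<And>x. x \<in> K \<Longrightarrow> \<Delta> x \<in> tensor_subspace k H H (carrier H) K"
    using K unfolding Sub_gen_iff is_subalgebra_def by auto
  note KH = subsetD[OF H.submoduleE(1)[OF sub]]
  note J = augmentation_ideal_submodule[OF sub]
  note carr = H.carrier_is_submodule
  show "submodule ?J k H" by (rule J)
  have "?J \<subseteq> {x \<in> carrier H. \<epsilon> x \<in> {\<zero>\<^bsub>k\<^esub>}}"
    by (rule product_span_least[OF linear_maps_preimage[OF H.module_axioms K.regular_module counit_functional]])
      (use KH module.zero_submodule[OF K.regular_module] in \<open>auto simp: augmentation_part_def counit_mult counit_closed\<close>)
  then show "\<forall>x\<in>?J. \<epsilon> x = \<zero>\<^bsub>k\<^esub>" by blast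
  let ?JH = "tensor_subspace k H H ?J (carrier H)" and ?HJ = "tensor_subspace k H H (carrier H) ?J"
  let ?r = "\<lambda>x. pure_tensor k H H x \<one>\<^bsub>H\<^esub>"
  note JH = R.AH.tensor_subspace_submodule[OF J carr] and HJ = R.AH.tensor_subspace_submodule[OF carr J]
  note E = R.AH.tensor_lift_linear[OF H.module_axioms R.counit_right_bilinear] R.AH.tensor_lift_pure[OF H.module_axioms R.counit_right_bilinear]
  have diff: "t \<otimes>\<^bsub>R.AH.TA\<^esub> w \<ominus>\<^bsub>R.AH.T\<^esub> ?r (tensor_lift k H (\<lambda>x y. \<epsilon> y \<odot>\<^bsub>H\<^esub> x) t) \<otimes>\<^bsub>R.AH.TA\<^esub> w \<in> ?HJ"
    (is "?G w t \<in> ?HJ")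
    if t: "t \<in> tensor_subspace k H H (carrier H) K" and w: "w \<in> carrier R.AH.T" for t w
  proof -
    have G: "?G w \<in> linear_maps k R.AH.T R.AH.T"
      by (intro linear_maps_difference R.AH.tensor_module R.AH.tensor_mult_left w
          linear_maps_compose[OF linear_maps_compose[OF E(1) R.AH.pure_left] R.AH.tensor_mult_left])
        simp
    have "tensor_subspace k H H (carrier H) K \<subseteq> {t \<in> carrier R.AH.T. ?G w t \<in> ?HJ}"
    proof (rule R.AH.tensor_subspace_leI[OF carr sub
          linear_maps_preimage[OF R.AH.tensor_module R.AH.tensor_module G HJ]])
      fix x y assume x: "x \<in> carrier H" and y: "y \<in> K"
      note yH = KH[OF y]
      let ?y = "y \<ominus>\<^bsub>H\<^esub> \<epsilon> y \<odot>\<^bsub>H\<^esub> \<one>\<^bsub>H\<^esub>"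
      have yy: "?y \<in> carrier H"
        using yH counit_closed by simp
      \<comment> \<open>The scalar \<open>\<epsilon> y\<close> moves to the second factor, where it combines with \<open>y\<close>.\<close>
      have r: "?r (\<epsilon> y \<odot>\<^bsub>H\<^esub> x) = pure_tensor k H H x (\<epsilon> y \<odot>\<^bsub>H\<^esub> \<one>\<^bsub>H\<^esub>)"
        using x yH counit_closed by (simp add: R.AH.pure_smult_left R.AH.pure_smult_right)
      have "?G w (pure_tensor k H H x y) = pure_tensor k H H x ?y \<otimes>\<^bsub>R.AH.TA\<^esub> w"
        using x yH w counit_closed
        by (simp add: E(2) r linear_maps_minus[OF H.module_axioms R.AH.tensor_module R.AH.pure_right]
            linear_maps_minus[OF R.AH.tensor_module R.AH.tensor_module R.AH.tensor_mult_left])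
      also have "\<dots> \<in> ?HJ"
        using w
      proof (induction rule: R.AH.tensor_induct)
        case (pure x' h)
        then show ?case
          using x yy minus_counit_mult_mem[OF alg y pure(2)]
          by (simp add: R.AH.tensor_mult_pure R.AH.tensor_subspace_pure[OF carr J])
      next
        case (add u v)
        then show ?case
          using x yy R.AH.T.submoduleE(5)[OF HJ]
          by (simp add: linear_maps_add[OF R.AH.tensor_mult_right])
      qed
      finally show "pure_tensor k H H x y \<in> {t \<in> carrier R.AH.T. ?G w t \<in> ?HJ}"
        using x yH by simp
    qed
    then show ?thesis using t by blast
  qed
  have left: "?r x \<otimes>\<^bsub>R.AH.TA\<^esub> w \<in> ?JH"
    if x: "x \<in> augmentation_part k \<epsilon> K" and w: "w \<in> carrier R.AH.T" for x w
  proof -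
    have xH: "x \<in> carrier H" using x KH by (auto simp: augmentation_part_def)
    show ?thesis
      using w
    proof (induction rule: R.AH.tensor_induct)
      case (pure x' h)
      then show ?case
        using xH product_span_mem[OF x pure(1)]
        by (simp add: R.AH.tensor_mult_pure R.AH.tensor_subspace_pure[OF J carr])
    next
      case (add u v)
      then show ?case
        using xH R.AH.T.submoduleE(5)[OF JH]
        by (simp add: linear_maps_add[OF R.AH.tensor_mult_right])
    qed
  qed
  let ?X = "?JH <+>\<^bsub>R.AH.T\<^esub> ?HJ"
  have "?J \<subseteq> {x \<in> carrier H. \<Delta> x \<in> ?X}"
  proof (rule product_span_least[OF linear_maps_preimage[OF H.module_axioms R.AH.tensor_module comult_linear
          R.AH.T.submodule_set_add[OF JH HJ]]])
    fix u h assume u: "u \<in> augmentation_part k \<epsilon> K" and h: "h \<in> carrier H"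
    have uK: "u \<in> K" and uH: "u \<in> carrier H" using u KH by (auto simp: augmentation_part_def)
    let ?p = "\<Delta> u \<otimes>\<^bsub>R.AH.TA\<^esub> \<Delta> h" and ?q = "?r u \<otimes>\<^bsub>R.AH.TA\<^esub> \<Delta> h"
    have c: "?p \<in> carrier R.AH.T" "?q \<in> carrier R.AH.T"
      using uH h by (auto intro!: bilinear_maps_closed[OF R.AH.tensor_mult_bilinear] R.coact_closed)
    have "?p \<ominus>\<^bsub>R.AH.T\<^esub> ?q \<in> ?HJ"
      using diff[OF \<Delta>K[OF uK] R.coact_closed[OF h]] counit_right[OF uH] by simp
    moreover have "?q \<in> ?JH"
      using left[OF u R.coact_closed[OF h]] .
    moreover have "?p = ?q \<oplus>\<^bsub>R.AH.T\<^esub> (?p \<ominus>\<^bsub>R.AH.T\<^esub> ?q)"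
      using c by (simp add: a_minus_def R.AH.T.M.a_lcomm R.AH.T.M.r_neg)
    ultimately have "?p \<in> ?X"
      unfolding set_add_def' by blast
    then show "u \<otimes>\<^bsub>H\<^esub> h \<in> {x \<in> carrier H. \<Delta> x \<in> ?X}"
      using uH h by (simp add: R.coact_mult)
  qed
  then show "\<Delta> ` ?J \<subseteq> ?X" by blast
qed

lemma augmentation_quotient_in_Quot_gen:
  assumes K: "K \<in> carrier (Sub_gen k H \<Delta>)"
  shows "quotient_module H (product_span k H (augmentation_part k \<epsilon> K) (carrier H)) \<in> carrier (Quot_gen k H \<Delta> \<epsilon>)"
  using augmentation_ideal_coideal[OF K] augmentation_ideal_right_ideal[of K] K
  unfolding Quot_gen_def Sub_gen_iff is_subalgebra_def by auto

end

section \<open>The quotient determined by a subalgebra\<close>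

context comodule_algebra begin

text \<open>
  Membership in \<open>A \<otimes> K\<close> and in \<open>H \<otimes> K\<close> is a condition on slices, hence compatible with
  intersections of the \<open>K\<close>.  The family is nonempty because it contains \<open>H\<close>.
\<close>

lemma Inter_coaction_supports:
  assumes S: "S \<subseteq> carrier A"
  shows "\<Inter>(coaction_supports k H \<Delta> A \<delta> S) \<in> coaction_supports k H \<Delta> A \<delta> S"
    (is "\<Inter>?C \<in> ?C")
proof -
  have C: "K \<in> ?C \<longleftrightarrow> (subring K H \<and> submodule K k H) \<and> (\<forall>x\<in>K. \<Delta> x \<in> tensor_subspace k H H (carrier H) K) \<and>
      (\<forall>s\<in>S. \<delta> s \<in> tensor_subspace k A H (carrier A) K)" for K
    unfolding coaction_supports_def Sub_gen_iff is_subalgebra_def by auto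
  have "carrier H \<in> ?C"
    unfolding C HH.tensor_subspace_carrier AH.tensor_subspace_carrier
    using S coact_closed linear_maps_closed[OF H.comult_linear] H.H.carrier_is_subring H.H.carrier_is_submodule
    by blast
  then have ne: "?C \<noteq> {}" by blast
  have sub: "submodule (\<Inter>?C) k H"
    using ne by (intro H.H.submodule_Inter) (auto simp: C)
  show ?thesis
    unfolding C
  proof (intro conjI ballI sub)
    show "subring (\<Inter>?C) H"
      using ne by (intro H.H.subring_Inter) (auto simp: C)
    show "\<delta> s \<in> tensor_subspace k A H (carrier A) (\<Inter>?C)" if s: "s \<in> S" for s
      using s ne AH.mem_tensor_subspace_iff unfolding AH.mem_tensor_subspace_iff[OF sub]
      by (auto simp: C)
    show "\<Delta> x \<in> tensor_subspace k H H (carrier H) (\<Inter>?C)" if x: "x \<in> \<Inter>?C" for x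
      using x ne HH.mem_tensor_subspace_iff unfolding HH.mem_tensor_subspace_iff[OF sub]
      by (auto simp: C)
  qed
qed

text \<open>
  For \<open>s \<in> S\<close> the slice \<open>\<delta>\<^sub>f s\<close> lies in \<open>K\<close>, so \<open>\<delta>\<^sub>f s - \<epsilon> (\<delta>\<^sub>f s) 1\<close> lies in \<open>K\<^sup>+\<close>; and
  \<open>\<epsilon> (\<delta>\<^sub>f s) = f s\<close> by the counit law.
\<close>

lemma coaction_support_coinvariants:
  assumes S: "S \<subseteq> carrier A" and K: "K \<in> coaction_supports k H \<Delta> A \<delta> S"
  shows "S \<subseteq> quotient_coinvariants k H A \<delta>
    (quotient_module H (product_span k H (augmentation_part k \<epsilon> K) (carrier H)))"
proof
  fix s assume s: "s \<in> S"
  have alg: "is_subalgebra k H K" and sub: "submodule K k H"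
    and \<delta>K: "\<delta> s \<in> tensor_subspace k A H (carrier A) K"
    using K s unfolding coaction_supports_def Sub_gen_iff is_subalgebra_def by auto
  have sA: "s \<in> carrier A" using s S by blast
  show "s \<in> quotient_coinvariants k H A \<delta>
    (quotient_module H (product_span k H (augmentation_part k \<epsilon> K) (carrier H)))"
    unfolding quotient_coinvariants_iff[OF H.augmentation_ideal_submodule[OF sub]]
  proof (intro conjI ballI sA)
    fix f assume f: "f \<in> functionals k A"
    have "coeff f s \<in> K"
      using AH.slice_subspace[OF sub f \<delta>K] .
    from H.minus_counit_mult_mem[OF alg this H.H.one_closed]
    show "coeff f s \<ominus>\<^bsub>H\<^esub> f s \<odot>\<^bsub>H\<^esub> \<one>\<^bsub>H\<^esub> \<in> product_span k H (augmentation_part k \<epsilon> K) (carrier H)"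
      using coeff_closed[OF f sA] linear_maps_closed[OF f sA] by (simp add: counit_coeff[OF f sA])
  qed
qed

lemma coinvariants_coaction_support:
  assumes I: "submodule I k H" "right_ideal I H"
    and S: "S \<subseteq> quotient_coinvariants k H A \<delta> (quotient_module H I)"
  shows "quotient_coinvariants k H H \<Delta> (quotient_module H I) \<in> coaction_supports k H \<Delta> A \<delta> S"
proof -
  note K = H.coinvariants_left_coideal_subalgebra[OF I]
  then have "submodule (quotient_coinvariants k H H \<Delta> (quotient_module H I)) k H"
    unfolding Sub_gen_iff is_subalgebra_def by blast
  then show ?thesis
    unfolding coaction_supports_def using K S coact_quotient_coinvariants[OF I(1)] by blast
qed

text \<open>
  The quotient \<open>H/K\<^sub>S\<^sup>+H\<close> belongs to the set whose supremum is taken and dominates all its members, so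
  it is a maximum, and the order is antisymmetric because the zero of \<open>H/I\<close> recovers \<open>I\<close>.
\<close>

theorem galois_psi_eq:
  assumes S: "S \<subseteq> carrier A"
  shows "galois_psi k H \<Delta> \<epsilon> A \<delta> S = quotient_module H
    (product_span k H (augmentation_part k \<epsilon> (\<Inter>(coaction_supports k H \<Delta> A \<delta> S))) (carrier H))"
    (is "_ = quotient_module H ?J")
proof -
  let ?K = "\<Inter>(coaction_supports k H \<Delta> A \<delta> S)" and ?L = "Quot_gen k H \<Delta> \<epsilon>"
  let ?Qs = "{Q \<in> carrier ?L. S \<subseteq> quotient_coinvariants k H A \<delta> Q}"
  note supp = Inter_coaction_supports[OF S]
  have K: "?K \<in> carrier (Sub_gen k H \<Delta>)"
    using supp unfolding coaction_supports_def by blast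
  have carrL: "Q \<in> carrier ?L \<longleftrightarrow> (\<exists>I. Q = quotient_module H I \<and> right_ideal I H \<and> coideal k H \<Delta> \<epsilon> I)" for Q
    by (auto simp: Quot_gen_def)
  have leL: "le ?L Q Q' \<longleftrightarrow> \<zero>\<^bsub>Q'\<^esub> \<subseteq> \<zero>\<^bsub>Q\<^esub>" for Q Q'
    by (simp add: Quot_gen_def)
  have antisym: "Q = Q'" if "Q \<in> carrier ?L" "Q' \<in> carrier ?L" "le ?L Q Q'" "le ?L Q' Q" for Q Q'
    using that unfolding carrL leL by auto
  have QJ: "quotient_module H ?J \<in> ?Qs"
    using H.augmentation_quotient_in_Quot_gen[OF K] coaction_support_coinvariants[OF S supp] by blast
  have max: "le ?L Q (quotient_module H ?J)" if Q: "Q \<in> ?Qs" for Q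
  proof -
    obtain I where I: "Q = quotient_module H I" "right_ideal I H" "submodule I k H"
      using Q unfolding mem_Collect_eq carrL coideal_def by blast
    let ?C = "quotient_coinvariants k H H \<Delta> (quotient_module H I)"
    have "?K \<subseteq> ?C"
      using coinvariants_coaction_support[OF I(3,2)] Q I(1) by blast
    then have "augmentation_part k \<epsilon> ?K \<subseteq> I"
      using H.augmentation_coinvariants[OF I(3)] unfolding augmentation_part_def by blast
    then have "?J \<subseteq> I"
      using I(2) by (intro H.product_span_least[OF I(3)]) (auto simp: right_ideal_def)
    then show ?thesis by (simp add: leL I(1))
  qed
  have least: "least ?L Q (Upper ?L ?Qs) \<longleftrightarrow> Q = quotient_module H ?J" for Q
    using QJ max antisym unfolding least_def Upper_def by (auto 0 4)
  show ?thesis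
    unfolding galois_psi_def sup_def least by simp
qed

end

theorem theorem4p2p4:
  fixes k :: "('k, 'r) ring_scheme" and H :: "('k, 'h) module" and A :: "('k, 'a) module"
    and \<Delta> :: "'h \<Rightarrow> ('h \<times> 'h \<Rightarrow> 'k) set" and \<epsilon> :: "'h \<Rightarrow> 'k"
    and \<delta> :: "'a \<Rightarrow> ('a \<times> 'h \<Rightarrow> 'k) set" and S :: "'a set"
  assumes "field k"
    and "hopf_algebra k H \<Delta> \<epsilon>"
    and "comodule_algebra k H \<Delta> \<epsilon> A \<delta>"
    and "S \<in> carrier (Sub_Alg k A (coinvariants k H A \<delta>))"
  defines "K\<^sub>S \<equiv> \<Inter>(coaction_supports k H \<Delta> A \<delta> S)"
  shows "least (Sub_gen k H \<Delta>) K\<^sub>S (coaction_supports k H \<Delta> A \<delta> S) \<and>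
    galois_psi k H \<Delta> \<epsilon> A \<delta> S =
      quotient_module H (product_span k H (augmentation_part k \<epsilon> K\<^sub>S) (carrier H))"
proof
  interpret comodule_algebra k H \<Delta> \<epsilon> A \<delta> by fact
  have S: "S \<subseteq> carrier A"
    using assms(4) A.submoduleE(1) unfolding Sub_Alg_def is_subalgebra_def by auto
  show "least (Sub_gen k H \<Delta>) K\<^sub>S (coaction_supports k H \<Delta> A \<delta> S)"
    unfolding least_def K\<^sub>S_def
    using Inter_coaction_supports[OF S] by (auto simp: coaction_supports_def Sub_gen_def)
  show "galois_psi k H \<Delta> \<epsilon> A \<delta> S =
      quotient_module H (product_span k H (augmentation_part k \<epsilon> K\<^sub>S) (carrier H))"
    unfolding K\<^sub>S_def by (rule galois_psi_eq[OF S])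
qed

end
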